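(* Let $\Theta=(\theta_1,\dots,\theta_m)\in(\mathbb R/2\pi\mathbb Z)^m$ have pairwise distinct phases. Let $F=(F_n)_{n\ge0}$ be a complex sequence with $\sum_{n\ge0}|F_n|r^n<\infty$ for $0<r<1$, and assume that the limits $$a_j=\lim_{r\uparrow1}(1-r)\sum_{n\ge0}F_nr^ne^{-in\theta_j}\qquad(1\le j\le m)$$ exist. Then $$A_\infty^d(F)\ge q_\Theta(a).$$ Moreover, $q_\Theta(a)$ is the infimum of $A_\infty^d(F)$ over all sequences $F$ constrained only by these conditions, i.e. for each $a\in\mathbb C^m$, over all $F$ satisfying the displayed convergence condition and having Abel coefficients $a_1,\dots,a_m$ at the phases $\Theta$.
   Context: $A_\infty^d(F)=\lim_{N\to\infty}\sup_{n\ge N}|F_n|\in[0,\infty]$. With $\Psi_\Theta(n)=(e^{in\theta_1},\dots,e^{in\theta_m})$, let $G_\Theta=\overline{\Psi_\Theta(\mathbb Z)}\subseteq\mathbb T^m$, $\mathbb T=\{|z|=1\}$ (a compact group) with Haar probability measure $m_\Theta$ and restricted coordinate characters $\chi_j(z)=z_j$. Then $$q_\Theta(a)=\inf\Bigl\{\|f\|_{L^\infty(G_\Theta)}:\ f\in L^\infty(G_\Theta),\ \int_{G_\Theta}f\overline{\chi_j}\,dm_\Theta=a_j\ (1\le j\le m)\Bigr\}.$$ *)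

theory Defs
  imports "HOL-Probability.Probability" "HOL-Library.Real_Mod"
begin

definition A_inf :: "(nat \<Rightarrow> complex) \<Rightarrow> ennreal" where
  "A_inf F = lim (\<lambda>N. SUP n\<in>{N..}. ennreal (norm (F n)))"

lemma A_inf_eq_limsup: "A_inf F = limsup (\<lambda>n. ennreal (norm (F n)))"
proof -
  let ?s = "\<lambda>N. SUP n\<in>{N..}. ennreal (norm (F n))"
  have "decseq ?s"
    by (auto simp: decseq_def intro!: SUP_subset_mono)
  then have "?s \<longlonglongrightarrow> (INF N. ?s N)"
    by (rule LIMSEQ_INF)
  then show ?thesis
    unfolding A_inf_def limsup_INF_SUP by (rule limI)
qed

text \<open>
  A point of \<open>(\<real>/2\<pi>\<int>)\<^sup>m\<close> is given by a vector of real representatives, indexed by a finite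
  type with \<open>m\<close> elements.
\<close>

definition distinct_phases :: "real ^ 'm \<Rightarrow> bool" where
  "distinct_phases \<theta> \<longleftrightarrow> (\<forall>i j. i \<noteq> j \<longrightarrow> \<not> [\<theta> $ i = \<theta> $ j] (rmod (2 * pi)))"

definition Psi_Theta :: "real ^ 'm \<Rightarrow> int \<Rightarrow> complex ^ 'm" where
  "Psi_Theta \<theta> n = (\<chi> j. exp (\<i> * of_int n * of_real (\<theta> $ j)))"

definition G_Theta :: "real ^ 'm \<Rightarrow> (complex ^ 'm) set" where
  "G_Theta \<theta> = closure (range (Psi_Theta \<theta>))"

text \<open>
  The product of vectors is componentwise, so it is the group operation of the torus. For a compact
  subgroup \<open>K\<close> of the torus there is exactly one measure with these properties; regularity
  is automatic because \<open>K\<close> is a compact metric space.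
\<close>

definition is_haar_prob :: "(complex ^ 'm) set \<Rightarrow> (complex ^ 'm) measure \<Rightarrow> bool" where
  "is_haar_prob K M \<longleftrightarrow>
     sets M = sets (restrict_space borel K) \<and> prob_space M \<and>
     (\<forall>g\<in>K. distr M M (\<lambda>z. g * z) = M)"

definition haar_prob :: "(complex ^ 'm) set \<Rightarrow> (complex ^ 'm) measure" where
  "haar_prob K = (THE M. is_haar_prob K M)"

definition Linf_norm :: "'a measure \<Rightarrow> ('a \<Rightarrow> complex) \<Rightarrow> ennreal" where
  "Linf_norm M f = esssup M (\<lambda>x. ennreal (norm (f x)))"

text \<open>Elements of \<open>L\<^sup>\<infinity>\<close> are represented by functions rather than classes modulo null sets.\<close>

definition Linf :: "'a measure \<Rightarrow> ('a \<Rightarrow> complex) set" where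
  "Linf M = {f \<in> borel_measurable M. Linf_norm M f < \<infinity>}"

definition q_Theta :: "real ^ 'm \<Rightarrow> complex ^ 'm \<Rightarrow> ennreal" where
  "q_Theta \<theta> a = (INF f \<in> {f \<in> Linf (haar_prob (G_Theta \<theta>)).
                      \<forall>j. (LINT z|haar_prob (G_Theta \<theta>). f z * cnj (z $ j)) = a $ j}.
              Linf_norm (haar_prob (G_Theta \<theta>)) f)"

definition abel_convergent :: "(nat \<Rightarrow> complex) \<Rightarrow> bool" where
  "abel_convergent F \<longleftrightarrow> (\<forall>r::real. 0 < r \<and> r < 1 \<longrightarrow> summable (\<lambda>n. norm (F n) * r ^ n))"

definition has_abel_coeff :: "(nat \<Rightarrow> complex) \<Rightarrow> real \<Rightarrow> complex \<Rightarrow> bool" where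
  "has_abel_coeff F t c \<longleftrightarrow>
     ((\<lambda>r::real. of_real (1 - r) *
          (\<Sum>n. F n * of_real r ^ n * exp (- (\<i> * of_nat n * of_real t)))) \<longlongrightarrow> c) (at_left 1)"

end

theory Submission
  imports Defs
begin

text \<open>
  Write \<open>G\<close> for the compact group generated by \<open>\<Psi>(1)\<close>, \<open>m\<close> for its Haar measure, and
  \<open>p\<^sub>c(z) = \<Sum>\<^sub>j c\<^sub>j cnj z\<^sub>j\<close>. Everything turns on one inequality for a coefficient vector \<open>a\<close>,

    (1)  \<open>\<bar>\<Sum>\<^sub>j c\<^sub>j a\<^sub>j\<bar> \<le> A \<integral>\<bar>p\<^sub>c\<bar> dm\<close>  for all \<open>c\<close>.

  It holds on both sides of the theorem. If \<open>a\<close> are the Abel coefficients of \<open>F\<close> and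
  \<open>A > A_inf F\<close>, then \<open>\<Sum>\<^sub>j c\<^sub>j a\<^sub>j\<close> is the limit of the Abel means of \<open>F\<^sub>n p\<^sub>c(\<Psi>(n))\<close>, which are
  bounded by \<open>A\<close> times the Abel means of \<open>\<bar>p\<^sub>c(\<Psi>(n))\<bar>\<close> up to an error that tends to 0, and the
  latter tend to \<open>\<integral>\<bar>p\<^sub>c\<bar> dm\<close> since the points \<open>\<Psi>(n)\<close> equidistribute in \<open>G\<close>
  (lemma \<open>abel_coefficients_bounded\<close>). If \<open>a\<close> are the coefficients of some \<open>f \<in> L\<^sup>\<infinity>\<close>, then
  \<open>\<Sum>\<^sub>j c\<^sub>j a\<^sub>j = \<integral>f p\<^sub>c dm\<close> and (1) holds with \<open>A = \<parallel>f\<parallel>\<^sub>\<infinity>\<close> (lemma \<open>Linf_coefficients_bounded\<close>).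

  Conversely, (1) yields for every \<open>\<epsilon> > 0\<close> a \<^emph>\<open>continuous\<close> \<open>g\<close> with \<open>\<bar>g\<bar> \<le> A + \<epsilon>\<close> on \<open>G\<close> and
  coefficients exactly \<open>a\<close> (lemma \<open>bounded_coefficients_imp_continuous\<close>): a hyperplane separating
  \<open>a\<close> from the coefficient vectors of continuous functions bounded by \<open>A\<close> would contradict (1),
  tested with \<open>- A cnj p\<^sub>c / (\<bar>p\<^sub>c\<bar> + \<delta>)\<close>, and the remaining small error is a trigonometric
  polynomial. This \<open>g\<close> serves twice: it is a competitor in the definition of \<open>q_Theta\<close>, and the
  sampled sequence \<open>g(\<Psi>(n))\<close> has Abel coefficients \<open>a\<close> by equidistribution. Hence
  \<open>q_Theta \<theta> a \<le> A_inf F\<close>, and sequences come as close to \<open>q_Theta \<theta> a\<close> as desired.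

  Haar measure and equidistribution come from one construction. Tychonoff's theorem turns the Abel
  means along any filter below \<open>r \<up> 1\<close> into a shift-invariant mean on bounded sequences
  (lemma \<open>abel_limit_mean\<close>). Kolmogorov's extension theorem realizes such a mean, evaluated along a
  sequence in a compact set, as integration against a probability measure
  (lemma \<open>representing_measure\<close>). Along \<open>\<Psi>(n)\<close> shift invariance makes that measure invariant under
  \<open>G\<close>; by uniqueness it is the Haar measure, whichever filter was chosen. So every limit point of
  the Abel means of \<open>\<phi>(\<Psi>(n))\<close> equals \<open>\<integral>\<phi> dm\<close> (lemma \<open>equidistribution\<close>).
\<close>

section \<open>Abel means and shift-invariant means\<close>

definition abel_mean :: "real \<Rightarrow> (nat \<Rightarrow> real) \<Rightarrow> real" where
  "abel_mean r f = (1 - r) * (\<Sum>n. f n * r ^ n)"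

lemma summable_bounded_power:
  fixes f :: "nat \<Rightarrow> 'a::{real_normed_div_algebra,banach}"
  assumes "bounded (range f)" "0 < r" "r < (1::real)"
  shows "summable (\<lambda>n. norm (f n) * r ^ n)" "summable (\<lambda>n. f n * of_real r ^ n)"
proof -
  obtain B where B: "\<And>n. norm (f n) \<le> B"
    using assms(1) by (auto simp: bounded_iff)
  have "summable (\<lambda>n. B * r ^ n)"
    using assms by (intro summable_mult summable_geometric) auto
  then show 1: "summable (\<lambda>n. norm (f n) * r ^ n)"
    using assms B by (elim summable_comparison_test') (auto intro!: mult_right_mono simp: abs_mult)
  show "summable (\<lambda>n. f n * of_real r ^ n)"
    by (rule summable_norm_cancel) (use 1 assms in \<open>simp add: norm_mult norm_power\<close>)
qed

lemma summable_abel: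
  assumes "bounded (range f)" "0 < r" "r < (1::real)"
  shows "summable (\<lambda>n. f n * r ^ n)"
  using summable_bounded_power(2)[OF assms] by simp

lemma bounded_range_add:
  fixes f g :: "nat \<Rightarrow> 'a::real_normed_vector"
  shows "bounded (range f) \<Longrightarrow> bounded (range g) \<Longrightarrow> bounded (range (\<lambda>n. f n + g n))"
  by (rule bounded_plus_comp)

lemma bounded_range_cmult:
  fixes f :: "nat \<Rightarrow> 'a::real_normed_algebra"
  shows "bounded (range f) \<Longrightarrow> bounded (range (\<lambda>n. c * f n))"
  using bounded_linear_image[OF _ bounded_linear_mult_right[of c], of "range f"]
  by (simp add: image_image)

lemma abel_mean_add:
  assumes "bounded (range f)" "bounded (range g)" "0 < r" "r < 1"
  shows "abel_mean r (\<lambda>n. f n + g n) = abel_mean r f + abel_mean r g"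
  using suminf_add[OF summable_abel[OF assms(1,3,4)] summable_abel[OF assms(2,3,4)]]
  by (simp add: abel_mean_def distrib_left[symmetric] distrib_right)

lemma abel_mean_cmult:
  assumes "bounded (range f)" "0 < r" "r < 1"
  shows "abel_mean r (\<lambda>n. c * f n) = c * abel_mean r f"
  using suminf_mult[OF summable_abel[OF assms], of c]
  by (simp add: abel_mean_def mult.assoc)

lemma abel_mean_mono:
  assumes "bounded (range f)" "bounded (range g)" "0 < r" "r < 1" "\<And>n. f n \<le> g n"
  shows "abel_mean r f \<le> abel_mean r g"
  unfolding abel_mean_def
  by (intro mult_left_mono suminf_le summable_abel mult_right_mono) (use assms in auto)

lemma abel_mean_const:
  assumes "0 < r" "r < 1"
  shows "abel_mean r (\<lambda>n. c) = c"
  using assms suminf_geometric[of r] suminf_mult[OF summable_geometric[of r], of c]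
  by (simp add: abel_mean_def)

lemma abel_mean_abs_le:
  assumes "0 < r" "r < 1" "\<And>n. \<bar>f n\<bar> \<le> B"
  shows "\<bar>abel_mean r f\<bar> \<le> B"
proof -
  have b: "bounded (range f)" using assms(3) by (auto simp: bounded_iff)
  have "abel_mean r f \<le> abel_mean r (\<lambda>n. B)" "abel_mean r (\<lambda>n. -B) \<le> abel_mean r f"
    using assms(3) by (intro abel_mean_mono[OF _ _ assms(1,2)] b; force simp: abs_le_iff minus_le_iff)+
  then show ?thesis
    using assms by (simp add: abel_mean_const abs_le_iff)
qed

text \<open>
  Shifting the sequence changes its Abel mean only by terms that vanish as \<open>r \<up> 1\<close>; this is the
  source of all invariance below.
\<close>

lemma abel_mean_Suc:
  assumes "bounded (range f)" "0 < r" "r < 1"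
  shows "r * abel_mean r (\<lambda>n. f (Suc n)) = abel_mean r f - (1 - r) * f 0"
proof -
  have b: "bounded (range (\<lambda>n. f (Suc n)))"
    using assms(1) by (rule bounded_subset) auto
  have "r * (\<Sum>n. f (Suc n) * r ^ n) = (\<Sum>n. f (Suc n) * r ^ Suc n)"
    using suminf_mult[OF summable_abel[OF b assms(2,3)], of r] by (simp add: mult_ac)
  also have "\<dots> = (\<Sum>n. f n * r ^ n) - f 0"
    using suminf_split_head[OF summable_abel[OF assms]] by simp
  finally have *: "r * (\<Sum>n. f (Suc n) * r ^ n) = (\<Sum>n. f n * r ^ n) - f 0" .
  have "r * abel_mean r (\<lambda>n. f (Suc n)) = (1 - r) * (r * (\<Sum>n. f (Suc n) * r ^ n))"
    by (simp add: abel_mean_def)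
  then show ?thesis
    unfolding * by (simp add: abel_mean_def right_diff_distrib)
qed

text \<open>
  A Banach limit, except that its values on unbounded sequences are arbitrary.
\<close>

locale invariant_mean =
  fixes L :: "(nat \<Rightarrow> real) \<Rightarrow> real"
  assumes add: "\<lbrakk>bounded (range f); bounded (range g)\<rbrakk> \<Longrightarrow> L (\<lambda>n. f n + g n) = L f + L g"
    and cmult: "bounded (range f) \<Longrightarrow> L (\<lambda>n. c * f n) = c * L f"
    and nonneg: "\<lbrakk>bounded (range f); \<And>n. 0 \<le> f n\<rbrakk> \<Longrightarrow> 0 \<le> L f"
    and one: "L (\<lambda>n. 1) = 1"
    and shift: "bounded (range f) \<Longrightarrow> L (\<lambda>n. f (Suc n)) = L f"

text \<open>
  The maps \<open>f \<mapsto> abel_mean r f\<close>, restricted to bounded sequences, lie in a product of compact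
  intervals, so they have a cluster point along \<open>F\<close>, and \<open>F\<close> can be refined until all of them
  converge at once. The freedom in \<open>F\<close> is what later gives convergence of the Abel means, and not
  only the existence of some limit.
\<close>

lemma abel_limit_mean:
  assumes F: "F \<noteq> bot" "F \<le> at_left (1::real)"
  obtains F' L where "F' \<noteq> bot" "F' \<le> F" "invariant_mean L"
    "\<And>f. bounded (range f) \<Longrightarrow> ((\<lambda>r. abel_mean r f) \<longlongrightarrow> L f) F'"
proof -
  define T where "T r f = (if bounded (range f) then abel_mean r f else 0)" for r f
  define B :: "(nat \<Rightarrow> real) \<Rightarrow> real" where "B f = (SUP n. \<bar>f n\<bar>)" for f
  have ev01: "\<forall>\<^sub>F r in at_left (1::real). 0 < r \<and> r < 1"
    by (metis (mono_tags, lifting) eventually_at_leftI greaterThanLessThan_iff zero_less_one)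
  then have evF: "\<forall>\<^sub>F r in F. 0 < r \<and> r < 1"
    using F(2) by (rule filter_leD[rotated])
  \<comment> \<open>Outside the bounded sequences \<open>T r\<close> is cut off to 0, so that all its values lie in a compact product.\<close>
  define C where "C = PiE UNIV (\<lambda>f. if bounded (range f) then cball 0 (B f) else {0 :: real})"
  have "compact C"
    unfolding C_def compactin_euclidean_iff[symmetric] euclidean_product_topology[symmetric]
    by (subst compactin_PiE) auto
  have "\<forall>\<^sub>F r in F. T r \<in> C"
    using evF
  proof eventually_elim
    case (elim r)
    show ?case
      unfolding C_def T_def B_def PiE_UNIV_domain
    proof (clarsimp, intro abel_mean_abs_le)
      fix f :: "nat \<Rightarrow> real" and n
      assume "bounded (range f)"
      then show "\<bar>f n\<bar> \<le> (SUP n. \<bar>f n\<bar>)"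
        by (intro cSUP_upper) (auto simp: bounded_iff bdd_above_def)
    qed (use elim in auto)
  qed
  then have "eventually (\<lambda>g. g \<in> C) (filtermap T F)"
    by (simp add: eventually_filtermap)
  then obtain L where L: "L \<in> C" "inf (nhds L) (filtermap T F) \<noteq> bot"
    using \<open>compact C\<close> F(1) unfolding compact_filter by (metis filtermap_bot_iff)
  define F' where "F' = inf F (filtercomap T (nhds L))"
  have "F' \<noteq> bot"
  proof
    assume "F' = bot"
    then obtain P Q where PQ: "eventually P F" "eventually Q (nhds L)" "\<And>r. \<not> (P r \<and> Q (T r))"
      unfolding F'_def trivial_limit_def eventually_inf eventually_filtercomap by metis
    have "eventually (\<lambda>g. \<exists>r. g = T r \<and> P r) (filtermap T F)"
      unfolding eventually_filtermap using PQ(1) by eventually_elim auto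
    with PQ(2) have "eventually (\<lambda>g. False) (inf (nhds L) (filtermap T F))"
      unfolding eventually_inf using PQ(3) by blast
    then show False using L(2) by (simp add: trivial_limit_def)
  qed
  have "F' \<le> F" by (simp add: F'_def)
  have "filterlim T (nhds L) F'"
    unfolding F'_def filterlim_iff_le_filtercomap by simp
  then have limT: "filterlim (\<lambda>r. T r f) (nhds (L f)) F'" for f
    by (rule continuous_on_tendsto_compose[where f = "\<lambda>T. T f" and s = UNIV, rotated]) auto
  have lim: "((\<lambda>r. abel_mean r f) \<longlongrightarrow> L f) F'" if "bounded (range f)" for f
    using limT[of f] that by (simp add: T_def)
  have "F' \<le> at_left 1" using \<open>F' \<le> F\<close> F(2) by simp
  then have ev: "\<forall>\<^sub>F r in F'. 0 < r \<and> r < 1"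
    using ev01 by (rule filter_leD)
  have tr: "((\<lambda>r. r) \<longlongrightarrow> 1) F'"
    using \<open>F' \<le> at_left 1\<close> by (rule tendsto_mono) (simp add: tendsto_ident_at)
  note uniq = tendsto_unique[OF \<open>F' \<noteq> bot\<close>]
  have "invariant_mean L"
  proof
    fix f g :: "nat \<Rightarrow> real" and c :: real
    assume f: "bounded (range f)"
    show "L (\<lambda>n. c * f n) = c * L f"
    proof (rule uniq[OF lim[OF bounded_range_cmult[OF f]]])
      show "((\<lambda>r. abel_mean r (\<lambda>n. c * f n)) \<longlongrightarrow> c * L f) F'"
        by (rule Lim_transform_eventually[OF tendsto_mult_left[OF lim[OF f]]])
           (use ev in eventually_elim, simp add: abel_mean_cmult f)
    qed
    show "0 \<le> L f" if "\<And>n. 0 \<le> f n"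
    proof (rule tendsto_lowerbound[OF lim[OF f] _ \<open>F' \<noteq> bot\<close>])
      show "\<forall>\<^sub>F r in F'. 0 \<le> abel_mean r f"
        using ev
      proof eventually_elim
        case (elim r)
        then show ?case
          using abel_mean_mono[of "\<lambda>_. 0" f r] abel_mean_const[of r 0] f that by simp
      qed
    qed
    have f': "bounded (range (\<lambda>n. f (Suc n)))"
      using f by (rule bounded_subset) auto
    show "L (\<lambda>n. f (Suc n)) = L f"
    proof (rule uniq)
      show "((\<lambda>r. r * abel_mean r (\<lambda>n. f (Suc n))) \<longlongrightarrow> L (\<lambda>n. f (Suc n))) F'"
        using tendsto_mult[OF tr lim[OF f']] by simp
      have "((\<lambda>r. abel_mean r f - (1 - r) * f 0) \<longlongrightarrow> L f - (1 - 1) * f 0) F'"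
        by (intro tendsto_intros lim f tr)
      then have "((\<lambda>r. abel_mean r f - (1 - r) * f 0) \<longlongrightarrow> L f) F'" by simp
      then show "((\<lambda>r. r * abel_mean r (\<lambda>n. f (Suc n))) \<longlongrightarrow> L f) F'"
        by (rule Lim_transform_eventually)
           (use ev in eventually_elim, simp add: abel_mean_Suc f)
    qed
    assume g: "bounded (range g)"
    show "L (\<lambda>n. f n + g n) = L f + L g"
    proof (rule uniq[OF lim[OF bounded_range_add[OF f g]]])
      show "((\<lambda>r. abel_mean r (\<lambda>n. f n + g n)) \<longlongrightarrow> L f + L g) F'"
        by (rule Lim_transform_eventually[OF tendsto_add[OF lim[OF f] lim[OF g]]])
           (use ev in eventually_elim, simp add: abel_mean_add f g)
    qed
  next
    have "((\<lambda>r. abel_mean r (\<lambda>n. 1)) \<longlongrightarrow> 1) F'"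
      by (rule tendsto_eventually) (use ev in eventually_elim, simp add: abel_mean_const)
    then show "L (\<lambda>n. 1) = 1"
      by (intro uniq[OF lim]) auto
  qed
  then show thesis
    using that \<open>F' \<noteq> bot\<close> \<open>F' \<le> F\<close> lim by blast
qed

section \<open>Representing a mean by a probability measure\<close>

context invariant_mean
begin

lemma zero: "L (\<lambda>n. 0) = 0"
  using cmult[of "\<lambda>n. 0" 0] by simp

lemma const: "L (\<lambda>n. c) = c"
  using cmult[of "\<lambda>n. 1" c] one by simp

lemma sum:
  assumes "finite I" "\<And>i. i \<in> I \<Longrightarrow> bounded (range (f i))"
  shows "L (\<lambda>n. \<Sum>i\<in>I. f i n) = (\<Sum>i\<in>I. L (f i))"
proof -
  have "bounded (range (\<lambda>n. \<Sum>i\<in>I. f i n)) \<and> L (\<lambda>n. \<Sum>i\<in>I. f i n) = (\<Sum>i\<in>I. L (f i))"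
    using assms by (induction I rule: finite_induct) (auto simp: zero add bounded_range_add)
  then show ?thesis by blast
qed

lemma mono:
  assumes "bounded (range f)" "bounded (range g)" "\<And>n. f n \<le> g n"
  shows "L f \<le> L g"
proof -
  have m: "bounded (range (\<lambda>n. - 1 * f n))"
    using assms(1) by (rule bounded_range_cmult)
  have "0 \<le> L (\<lambda>n. g n + (- 1) * f n)"
    by (rule nonneg[OF bounded_range_add[OF assms(2) m]]) (use assms(3) in simp)
  also have "\<dots> = L g - L f"
    using add[OF assms(2) m] cmult[OF assms(1), of "-1"] by simp
  finally show ?thesis by simp
qed

lemma bounded_indicator: "bounded (range (\<lambda>n. indicator (A n) (y n) :: real))"
  by (auto simp: bounded_iff indicator_def intro!: exI[of _ 1])

text \<open>
  The set function \<open>A \<mapsto> L (\<lambda>n. indicator A (y n))\<close> is only finitely additive in general. If \<open>y\<close>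
  takes finitely many values, at most finitely many members of a disjoint family meet them, so that
  it is a measure.
\<close>

definition law :: "'b measure \<Rightarrow> (nat \<Rightarrow> 'b) \<Rightarrow> 'b measure" where
  "law M y = measure_of (space M) (sets M) (\<lambda>A. ennreal (L (\<lambda>n. indicator A (y n))))"

lemma sets_law [simp, measurable_cong]: "sets (law M y) = sets M"
  by (simp add: law_def)

lemma space_law [simp]: "space (law M y) = space M"
  by (simp add: law_def)

lemma emeasure_law:
  fixes y :: "nat \<Rightarrow> 'b"
  assumes fin: "finite (range y)" and A: "A \<in> sets M"
  shows "emeasure (law M y) A = ennreal (L (\<lambda>n. indicator A (y n)))"
proof (rule emeasure_measure_of[OF law_def])
  show "sets M \<subseteq> Pow (space M)" by (rule sets.space_closed)
  show "A \<in> sets (law M y)" using A by simp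
  show "positive (sets (law M y)) (\<lambda>A. ennreal (L (\<lambda>n. indicator A (y n))))"
    by (simp add: positive_def zero)
  show "countably_additive (sets (law M y)) (\<lambda>A. ennreal (L (\<lambda>n. indicator A (y n))))"
  proof (rule countably_additiveI)
    fix B :: "nat \<Rightarrow> 'b set"
    assume disj: "disjoint_family B"
    define I where "I = {i. B i \<inter> range y \<noteq> {}}"
    have "finite {i. v \<in> B i}" for v
    proof (cases "\<exists>i. v \<in> B i")
      case True
      then obtain i where "v \<in> B i" ..
      then have "{i. v \<in> B i} \<subseteq> {i}"
        using disj by (auto simp: disjoint_family_on_def)
      then show ?thesis by (rule finite_subset) simp
    qed simp
    moreover have "I = (\<Union>v\<in>range y. {i. v \<in> B i})"
      by (auto simp: I_def)
    ultimately have I: "finite I"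
      by (simp only:) (rule finite_UN_I[OF fin])
    have nn: "0 \<le> L (\<lambda>n. indicator (B i) (y n))" for i
      by (rule nonneg[OF bounded_indicator]) simp
    have "(\<Sum>i. ennreal (L (\<lambda>n. indicator (B i) (y n)))) = (\<Sum>i\<in>I. ennreal (L (\<lambda>n. indicator (B i) (y n))))"
    proof (rule suminf_finite[OF I])
      fix i assume "i \<notin> I"
      then have "(\<lambda>n. indicator (B i) (y n)) = (\<lambda>n. 0 :: real)"
        by (auto simp: I_def indicator_def fun_eq_iff)
      then show "ennreal (L (\<lambda>n. indicator (B i) (y n))) = 0"
        by (simp add: zero)
    qed
    also have "\<dots> = ennreal (\<Sum>i\<in>I. L (\<lambda>n. indicator (B i) (y n)))"
      using nn by (simp add: sum_ennreal)
    also have "(\<Sum>i\<in>I. L (\<lambda>n. indicator (B i) (y n))) = L (\<lambda>n. \<Sum>i\<in>I. indicator (B i) (y n))"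
      by (rule sum[symmetric]) (rule I, rule bounded_indicator)
    also have "(\<lambda>n. \<Sum>i\<in>I. indicator (B i) (y n) :: real) = (\<lambda>n. indicator (\<Union>i\<in>I. B i) (y n))"
      by (intro ext, subst indicator_UN_disjoint)
         (use I disj in \<open>auto simp: disjoint_family_on_def\<close>)
    also have "\<dots> = (\<lambda>n. indicator (\<Union>i. B i) (y n))"
      by (auto simp: I_def indicator_def fun_eq_iff)
    finally show "(\<Sum>i. ennreal (L (\<lambda>n. indicator (B i) (y n)))) =
        ennreal (L (\<lambda>n. indicator (\<Union>i. B i) (y n)))" .
  qed
qed

lemma prob_space_law:
  assumes "finite (range y)" "range y \<subseteq> space M"
  shows "prob_space (law M y)"
proof
  have "(\<lambda>n. indicator (space M) (y n)) = (\<lambda>n. 1 :: real)"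
    using assms(2) by (auto simp: fun_eq_iff indicator_def)
  then show "emeasure (law M y) (space (law M y)) = 1"
    using assms(1) by (simp add: emeasure_law one)
qed

lemma distr_law:
  assumes "finite (range y)" "range y \<subseteq> space M" "f \<in> measurable M N"
  shows "distr (law M y) N f = law N (\<lambda>n. f (y n))"
proof (rule measure_eqI)
  fix A assume "A \<in> sets (distr (law M y) N f)"
  then have A: "A \<in> sets N" by simp
  have fin: "finite (range (\<lambda>n. f (y n)))"
    using finite_imageI[OF assms(1), of f] by (simp add: image_image)
  have "emeasure (distr (law M y) N f) A = emeasure (law M y) (f -` A \<inter> space M)"
    using assms(3) A by (subst emeasure_distr) auto
  also have "\<dots> = ennreal (L (\<lambda>n. indicator (f -` A \<inter> space M) (y n)))"
    using assms(3) A by (intro emeasure_law assms(1) measurable_sets)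
  also have "(\<lambda>n. indicator (f -` A \<inter> space M) (y n)) = (\<lambda>n. indicator A (f (y n)) :: real)"
    using assms(2) by (auto simp: indicator_def fun_eq_iff)
  also have "ennreal (L \<dots>) = emeasure (law N (\<lambda>n. f (y n))) A"
    by (rule emeasure_law[OF fin A, symmetric])
  finally show "emeasure (distr (law M y) N f) A = emeasure (law N (\<lambda>n. f (y n))) A" .
qed simp

text \<open>
  The joint distributions, under \<open>L\<close>, of finitely many of the sequences \<open>c k\<close> form a projective
  family; Kolmogorov's extension theorem supplies the countable additivity that \<open>L\<close> lacks.
\<close>

lemma realize_finite_valued:
  fixes c :: "nat \<Rightarrow> nat \<Rightarrow> 'a::polish_space"
  assumes fin: "\<And>k. finite (range (c k))"
  obtains P where "prob_space P" "sets P = sets (PiM UNIV (\<lambda>_. borel :: 'a measure))"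
    "\<And>J. finite J \<Longrightarrow> distr P (PiM J (\<lambda>_. borel)) (\<lambda>\<omega>. restrict \<omega> J)
        = law (PiM J (\<lambda>_. borel)) (\<lambda>n. \<lambda>k\<in>J. c k n)"
proof -
  define Q where "Q J = law (PiM J (\<lambda>_. borel :: 'a measure)) (\<lambda>n. \<lambda>k\<in>J. c k n)" for J
  have finJ: "finite (range (\<lambda>n. \<lambda>k\<in>J. c k n))" if "finite J" for J
    by (rule finite_subset[of _ "PiE J (\<lambda>k. range (c k))"])
       (use fin that in \<open>auto intro!: finite_PiE\<close>)
  interpret PF: polish_projective UNIV Q
  proof (rule polish_projective.intro, rule projective_family.intro)
    fix J H :: "nat set"
    assume "J \<subseteq> H" "finite H"
    have "distr (Q H) (PiM J (\<lambda>_. borel)) (\<lambda>f. restrict f J)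
        = law (PiM J (\<lambda>_. borel)) (\<lambda>n. restrict (\<lambda>k\<in>H. c k n) J)"
      unfolding Q_def
      by (rule distr_law[OF finJ[OF \<open>finite H\<close>] _ measurable_restrict_subset[OF \<open>J \<subseteq> H\<close>]])
         (auto simp: space_PiM)
    moreover have "restrict (\<lambda>k\<in>H. c k n) J = (\<lambda>k\<in>J. c k n)" for n
      using \<open>J \<subseteq> H\<close> by (auto simp: restrict_def fun_eq_iff)
    ultimately show "Q J = distr (Q H) (PiM J (\<lambda>_. borel)) (\<lambda>f. restrict f J)"
      by (simp add: Q_def)
  next
    fix J :: "nat set" assume "finite J"
    then show "prob_space (Q J)"
      unfolding Q_def by (intro prob_space_law finJ) (auto simp: space_PiM)
  qed
  show thesis
  proof
    show "prob_space PF.lim" by (rule PF.P.prob_space_axioms)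
    show "sets PF.lim = sets (PiM UNIV (\<lambda>_. borel :: 'a measure))" by simp
    fix J :: "nat set" assume J: "finite J"
    have "distr PF.lim (PiM J (\<lambda>_. borel)) (\<lambda>\<omega>. restrict \<omega> J) = Q J"
    proof (rule measure_eqI)
      fix A assume "A \<in> sets (distr PF.lim (PiM J (\<lambda>_. borel)) (\<lambda>\<omega>. restrict \<omega> J))"
      then have A: "A \<in> sets (PiM J (\<lambda>_. borel :: 'a measure))" by simp
      have "emeasure (distr PF.lim (PiM J (\<lambda>_. borel)) (\<lambda>\<omega>. restrict \<omega> J)) A
          = emeasure PF.lim (PF.emb UNIV J A)"
        using A by (subst emeasure_distr)
          (auto simp: prod_emb_def space_PiM measurable_cong_sets[OF PF.sets_lim refl] Int_commute
            intro!: measurable_restrict_subset arg_cong2[where f = emeasure])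
      also have "\<dots> = emeasure (Q J) A"
        using J A by (intro PF.emeasure_lim_emb) auto
      finally show "emeasure (distr PF.lim (PiM J (\<lambda>_. borel)) (\<lambda>\<omega>. restrict \<omega> J)) A
          = emeasure (Q J) A" .
    qed (simp add: Q_def)
    then show "distr PF.lim (PiM J (\<lambda>_. borel)) (\<lambda>\<omega>. restrict \<omega> J)
        = law (PiM J (\<lambda>_. borel)) (\<lambda>n. \<lambda>k\<in>J. c k n)"
      by (simp add: Q_def)
  qed
qed

end

text \<open>
  Replace \<open>x\<close> by approximations \<open>c k\<close> with finitely many values and
  \<open>dist (c k n) (x n) < (1/2)^k\<close>, and realize all of them on one probability space. There the
  coordinates almost surely form a Cauchy sequence, because closeness of two coordinates is an event
  of a finite marginal. The law of their limit \<open>X\<close> is the required measure: of the equal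
  numbers \<open>E \<phi>(\<omega>\<^sub>k)\<close> and \<open>L (\<phi> \<circ> c k)\<close>, the first converge to \<open>E \<phi>(X)\<close> by dominated
  convergence, the second to \<open>L (\<phi> \<circ> x)\<close> by uniform continuity of \<open>\<phi>\<close> on \<open>K\<close>.
\<close>

lemma (in invariant_mean) representing_measure:
  fixes x :: "nat \<Rightarrow> 'a::euclidean_space"
  assumes K: "compact K" and xK: "\<And>n. x n \<in> K"
  obtains N where "prob_space N" "sets N = sets borel" "AE z in N. z \<in> K"
    "\<And>\<phi> :: 'a \<Rightarrow> real. continuous_on UNIV \<phi> \<Longrightarrow> (LINT z|N. \<phi> z) = L (\<lambda>n. \<phi> (x n))"
proof -
  have "\<exists>V. finite V \<and> V \<subseteq> K \<and> K \<subseteq> (\<Union>v\<in>V. ball v ((1/2) ^ k))" for k :: nat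
    using compactE_image[OF K, of K "\<lambda>v. ball v ((1/2) ^ k)"]
    by (metis UN_I centre_in_ball open_ball subsetI zero_less_divide_1_iff zero_less_numeral zero_less_power)
  then have "\<exists>V. \<forall>k :: nat. finite (V k) \<and> V k \<subseteq> K \<and> K \<subseteq> (\<Union>v\<in>V k. ball v ((1/2) ^ k))"
    by (intro choice) blast
  then obtain V where V: "\<And>k :: nat. finite (V k)" "\<And>k. V k \<subseteq> K"
      "\<And>k. K \<subseteq> (\<Union>v\<in>V k. ball v ((1/2) ^ k))"
    by blast
  have "\<exists>v\<in>V k. dist v (x n) < (1/2) ^ k" for k n
    using V(3)[of k] xK[of n] by (meson UN_E mem_ball subsetD)
  then obtain c where cV: "\<And>k n. c k n \<in> V k" and cx: "\<And>k n. dist (c k n) (x n) < (1/2) ^ k"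
    by metis
  have fin: "finite (range (c k))" for k
    by (rule finite_subset[OF _ V(1)[of k]]) (use cV in auto)
  let ?B = "\<lambda>_ :: nat. borel :: 'a measure"
  obtain P where "prob_space P" and sets_P: "sets P = sets (PiM UNIV ?B)"
    and P: "\<And>J. finite J \<Longrightarrow> distr P (PiM J ?B) (\<lambda>\<omega>. restrict \<omega> J) = law (PiM J ?B) (\<lambda>n. \<lambda>k\<in>J. c k n)"
    using realize_finite_valued[of c, OF fin] by metis
  interpret P: prob_space P by fact
  note [measurable_cong] = sets_P
  have space_P: "space P = UNIV"
    using sets_eq_imp_space_eq[OF sets_P] by (simp add: space_PiM)
  have event: "P.prob {\<omega>\<in>space P. restrict \<omega> J \<in> A} = L (\<lambda>n. indicator A (\<lambda>k\<in>J. c k n))"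
    if J: "finite J" and A: "A \<in> sets (PiM J ?B)" for J A
  proof -
    have finJ: "finite (range (\<lambda>n. \<lambda>k\<in>J. c k n))"
      by (rule finite_subset[of _ "PiE J (\<lambda>k. range (c k))"])
         (use fin J in \<open>auto intro!: finite_PiE\<close>)
    have "emeasure P {\<omega>\<in>space P. restrict \<omega> J \<in> A} = emeasure (distr P (PiM J ?B) (\<lambda>\<omega>. restrict \<omega> J)) A"
      using A by (subst emeasure_distr)
        (auto simp: measurable_cong_sets[OF sets_P refl] intro!: measurable_restrict_subset
          arg_cong2[where f = emeasure])
    also have "\<dots> = ennreal (L (\<lambda>n. indicator A (\<lambda>k\<in>J. c k n)))"
      unfolding P[OF J] by (rule emeasure_law[OF finJ A])
    finally show ?thesis
      using nonneg[OF bounded_indicator, of "\<lambda>_. A" "\<lambda>n. \<lambda>k\<in>J. c k n"]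
      by (simp add: P.emeasure_eq_measure)
  qed
  have coord [measurable]: "(\<lambda>\<omega>. \<omega> k) \<in> borel_measurable P" for k
    unfolding measurable_cong_sets[OF sets_P refl] by (rule measurable_component_singleton) simp
  have law1: "P.prob {\<omega>\<in>space P. \<omega> k \<in> A} = L (\<lambda>n. indicator A (c k n))"
    if [measurable]: "A \<in> sets borel" for k A
  proof -
    have "{f \<in> space (PiM {k} ?B). f k \<in> A} \<in> sets (PiM {k} ?B)"
      by measurable
    from event[OF _ this] show ?thesis
      by (simp add: space_PiM indicator_def)
  qed
  have inV: "AE \<omega> in P. \<omega> k \<in> V k" for k
  proof (rule P.AE_prob_1[THEN AE_mp])
    have "V k \<in> sets borel" using V(1) by (simp add: finite_imp_closed borel_closed)
    then show "P.prob {\<omega>\<in>space P. \<omega> k \<in> V k} = 1"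
      using cV by (simp add: law1 one)
  qed simp
  have close: "AE \<omega> in P. dist (\<omega> k) (\<omega> l) \<le> (1/2) ^ k + (1/2) ^ l" for k l
  proof (rule P.AE_prob_1[THEN AE_mp])
    have "{f \<in> space (PiM {k, l} ?B). dist (f k) (f l) \<le> (1/2) ^ k + (1/2) ^ l} \<in> sets (PiM {k, l} ?B)"
      by measurable
    note event[OF _ this]
    moreover have "dist (c k n) (c l n) \<le> (1/2) ^ k + (1/2) ^ l" for n
      using dist_triangle2[of "c k n" "c l n" "x n"] cx[of k n] cx[of l n] by linarith
    ultimately show "P.prob {\<omega>\<in>space P. dist (\<omega> k) (\<omega> l) \<le> (1/2) ^ k + (1/2) ^ l} = 1"
      by (simp add: space_PiM one)
  qed simp
  have good: "AE \<omega> in P. (\<forall>k. \<omega> k \<in> V k) \<and> (\<forall>k l. dist (\<omega> k) (\<omega> l) \<le> (1/2) ^ k + (1/2) ^ l)"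
    using inV close by (simp add: AE_all_countable)
  have conv: "convergent \<omega>" if "\<And>k l. dist (\<omega> k) (\<omega> l) \<le> (1/2) ^ k + (1/2) ^ l" for \<omega> :: "nat \<Rightarrow> 'a"
  proof (rule Cauchy_convergent, rule metric_CauchyI)
    fix e :: real assume "0 < e"
    then obtain M where M: "(1/2) ^ M < e / 2"
      using real_arch_pow_inv[of "e/2" "1/2"] by auto
    have "dist (\<omega> k) (\<omega> l) < e" if "k \<ge> M" "l \<ge> M" for k l
    proof -
      have "(1/2 :: real) ^ k \<le> (1/2) ^ M" "(1/2 :: real) ^ l \<le> (1/2) ^ M"
        using that by (auto intro!: power_decreasing)
      then show ?thesis
        using \<open>\<And>k l. dist (\<omega> k) (\<omega> l) \<le> (1/2) ^ k + (1/2) ^ l\<close>[of k l] M by linarith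
    qed
    then show "\<exists>M. \<forall>k\<ge>M. \<forall>l\<ge>M. dist (\<omega> k) (\<omega> l) < e" by blast
  qed
  define X where "X \<omega> = lim \<omega>" for \<omega> :: "nat \<Rightarrow> 'a"
  have X [measurable]: "X \<in> borel_measurable P"
    unfolding X_def by (rule borel_measurable_lim_metric[of "\<lambda>k \<omega>. \<omega> k", OF coord])
  have limX: "AE \<omega> in P. (\<lambda>k. \<omega> k) \<longlonglongrightarrow> X \<omega>"
    using good by eventually_elim (auto simp: X_def convergent_LIMSEQ_iff[symmetric] intro: conv)
  have XK: "AE \<omega> in P. X \<omega> \<in> K"
    using good limX
  proof eventually_elim
    case (elim \<omega>)
    show ?case
      by (rule closed_sequentially[OF compact_imp_closed[OF K] _ elim(2)]) (use elim(1) V(2) in auto)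
  qed
  show thesis
  proof
    show "prob_space (distr P borel X)" by (rule P.prob_space_distr[OF X])
    show "sets (distr P borel X) = sets borel" by simp
    have [measurable]: "K \<in> sets borel" using K by (simp add: compact_imp_closed borel_closed)
    show "AE z in distr P borel X. z \<in> K"
      using XK by (subst AE_distr_iff) auto
    fix \<phi> :: "'a \<Rightarrow> real" assume \<phi>: "continuous_on UNIV \<phi>"
    then have [measurable]: "\<phi> \<in> borel_measurable borel" by (rule borel_measurable_continuous_onI)
    have \<phi>K: "continuous_on K \<phi>" using \<phi> by (rule continuous_on_subset) simp
    obtain B where B: "\<And>z. z \<in> K \<Longrightarrow> \<bar>\<phi> z\<bar> \<le> B"
      using compact_imp_bounded[OF compact_continuous_image[OF \<phi>K K]] by (auto simp: bounded_iff)
    have bd: "bounded (range (\<lambda>n. \<phi> (z n)))" if "\<And>n. z n \<in> K" for z :: "nat \<Rightarrow> 'a"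
      using B that by (auto simp: bounded_iff)
    have cK: "c k n \<in> K" for k n using cV V(2) by blast
    have "(LINT \<omega>|P. \<phi> (\<omega> k)) = L (\<lambda>n. \<phi> (c k n))" for k
    proof -
      \<comment> \<open>The coordinate \<open>k\<close> lives on the finite set \<open>V k\<close>, so its expectation is a finite sum over events.\<close>
      have dec: "\<phi> v = (\<Sum>w\<in>V k. \<phi> w * indicator {w} v)" if "v \<in> V k" for v
        using that V(1)[of k] by (simp add: indicator_def if_distrib cong: if_cong)
      have m [measurable]: "{\<omega>\<in>space P. \<omega> k = w} \<in> sets P" for w
        using measurable_sets[OF coord[of k], of "{w}"] by (simp add: vimage_def space_P)
      have "AE \<omega> in P. \<phi> (\<omega> k) = (\<Sum>w\<in>V k. \<phi> w * indicator {\<omega>\<in>space P. \<omega> k = w} \<omega>)"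
        using inV[of k]
        by eventually_elim (subst dec, auto intro!: sum.cong simp: indicator_def space_P)
      then have "(LINT \<omega>|P. \<phi> (\<omega> k)) = (LINT \<omega>|P. (\<Sum>w\<in>V k. \<phi> w * indicator {\<omega>\<in>space P. \<omega> k = w} \<omega>))"
        using m by (intro integral_cong_AE borel_measurable_sum borel_measurable_times) auto
      also have "\<dots> = (\<Sum>w\<in>V k. \<phi> w * P.prob {\<omega>\<in>space P. \<omega> k = w})"
        using m by (subst Bochner_Integration.integral_sum)
          (auto simp: P.emeasure_eq_measure integrable_real_indicator)
      also have "\<dots> = (\<Sum>w\<in>V k. L (\<lambda>n. \<phi> w * indicator {w} (c k n)))"
        using law1[of "{w}" k for w] by (intro sum.cong refl) (simp add: cmult bounded_indicator)
      also have "\<dots> = L (\<lambda>n. \<Sum>w\<in>V k. \<phi> w * indicator {w} (c k n))"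
        by (rule sum[symmetric]) (auto intro!: bounded_range_cmult bounded_indicator V(1))
      also have "(\<lambda>n. \<Sum>w\<in>V k. \<phi> w * indicator {w} (c k n)) = (\<lambda>n. \<phi> (c k n))"
        using dec[OF cV] by simp
      finally show ?thesis .
    qed
    moreover have "(\<lambda>k. LINT \<omega>|P. \<phi> (\<omega> k)) \<longlonglongrightarrow> (LINT \<omega>|P. \<phi> (X \<omega>))"
    proof (rule integral_dominated_convergence[where w = "\<lambda>_. B"])
      show "AE \<omega> in P. (\<lambda>k. \<phi> (\<omega> k)) \<longlonglongrightarrow> \<phi> (X \<omega>)"
        using limX
      proof eventually_elim
        case (elim \<omega>)
        show ?case by (rule continuous_on_tendsto_compose[OF \<phi> elim]) auto
      qed
      show "AE \<omega> in P. norm (\<phi> (\<omega> k)) \<le> B" for k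
        using inV[of k] by eventually_elim (use B V(2) in auto)
    qed auto
    moreover have "(\<lambda>k. L (\<lambda>n. \<phi> (c k n))) \<longlonglongrightarrow> L (\<lambda>n. \<phi> (x n))"
    proof (rule LIMSEQ_I)
      fix e :: real assume "0 < e"
      have "uniformly_continuous_on K \<phi>" by (rule compact_uniformly_continuous[OF \<phi>K K])
      then obtain d where d: "0 < d" "\<And>y z. y \<in> K \<Longrightarrow> z \<in> K \<Longrightarrow> dist y z < d \<Longrightarrow> dist (\<phi> y) (\<phi> z) < e / 2"
        using \<open>0 < e\<close> unfolding uniformly_continuous_on_def by (metis half_gt_zero)
      obtain M where M: "(1/2) ^ M < d"
        using real_arch_pow_inv[of d "1/2"] d(1) by auto
      have "norm (L (\<lambda>n. \<phi> (c k n)) - L (\<lambda>n. \<phi> (x n))) < e" if "k \<ge> M" for k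
      proof -
        have pt: "\<bar>\<phi> (c k n) - \<phi> (x n)\<bar> \<le> e / 2" for n
        proof -
          have "(1/2 :: real) ^ k \<le> (1/2) ^ M" using that by (intro power_decreasing) auto
          then have "dist (c k n) (x n) < d" using cx[of k n] M by linarith
          then show ?thesis using d(2)[OF cK xK] by (force simp: dist_real_def)
        qed
        have le: "\<phi> (c k n) \<le> \<phi> (x n) + e / 2" "\<phi> (x n) \<le> \<phi> (c k n) + e / 2" for n
          using pt[of n] by (simp_all only: abs_le_iff) linarith+
        have shift_const: "L (\<lambda>n. f n + e / 2) = L f + e / 2" if "bounded (range f)" for f
          using add[OF that, of "\<lambda>_. e / 2"] by (simp add: const)
        have "L (\<lambda>n. \<phi> (c k n)) \<le> L (\<lambda>n. \<phi> (x n) + e / 2)"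
          by (intro mono bounded_range_add bd cK xK le) auto
        moreover have "L (\<lambda>n. \<phi> (x n)) \<le> L (\<lambda>n. \<phi> (c k n) + e / 2)"
          by (intro mono bounded_range_add bd cK xK le) auto
        ultimately show ?thesis
          using \<open>0 < e\<close> by (simp add: shift_const bd cK xK abs_less_iff)
      qed
      then show "\<exists>M. \<forall>k\<ge>M. norm (L (\<lambda>n. \<phi> (c k n)) - L (\<lambda>n. \<phi> (x n))) < e" by blast
    qed
    ultimately have "(LINT \<omega>|P. \<phi> (X \<omega>)) = L (\<lambda>n. \<phi> (x n))"
      using LIMSEQ_unique by simp
    then show "(LINT z|distr P borel X. \<phi> z) = L (\<lambda>n. \<phi> (x n))"
      by (subst integral_distr) auto
  qed
qed

text \<open>
  The indicator of a closed set is the pointwise limit of \<open>max 0 (1 - n * infdist z C)\<close>, and closed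
  sets generate the Borel sets.
\<close>

lemma measure_eqI_continuous_integrals:
  fixes M N :: "'a::metric_space measure"
  assumes M: "finite_measure M" "sets M = sets borel"
    and N: "finite_measure N" "sets N = sets borel"
    and eq: "\<And>\<phi> :: 'a \<Rightarrow> real. continuous_on UNIV \<phi> \<Longrightarrow> bounded (range \<phi>) \<Longrightarrow> (LINT z|M. \<phi> z) = (LINT z|N. \<phi> z)"
  shows "M = N"
proof (rule measure_eqI_generator_eq[where \<Omega> = UNIV and E = "Collect closed" and A = "\<lambda>_. UNIV"])
  interpret M: finite_measure M by fact
  interpret N: finite_measure N by fact
  show "sets M = sigma_sets UNIV (Collect closed)" "sets N = sigma_sets UNIV (Collect closed)"
    using M(2) N(2) by (simp_all add: borel_eq_closed)
  show "emeasure M UNIV \<noteq> \<infinity>" by simp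
  fix C :: "'a set" assume "C \<in> Collect closed"
  then have C: "closed C" by simp
  have "emeasure M C = emeasure N C" if ne: "C \<noteq> {}"
  proof -
    define \<phi> where "\<phi> n z = max 0 (1 - real n * infdist z C)" for n z
    have cont: "continuous_on UNIV (\<phi> n)" for n
      unfolding \<phi>_def by (intro continuous_intros)
    have bd: "\<bar>\<phi> n z\<bar> \<le> 1" for n z
      by (simp add: \<phi>_def infdist_nonneg)
    have lim: "(\<lambda>n. \<phi> n z) \<longlonglongrightarrow> indicator C z" for z
    proof (cases "z \<in> C")
      case True
      then show ?thesis by (simp add: \<phi>_def)
    next
      case False
      then have "0 < infdist z C"
        using in_closed_iff_infdist_zero[OF C ne] infdist_nonneg[of z C] by (metis less_eq_real_def)
      then obtain n0 where n0: "1 < real n0 * infdist z C"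
        using reals_Archimedean3 by blast
      have "\<phi> n z = 0" if "n \<ge> n0" for n
      proof -
        have "real n0 * infdist z C \<le> real n * infdist z C"
          using that by (intro mult_right_mono) (auto simp: infdist_nonneg)
        then show ?thesis using n0 by (simp add: \<phi>_def)
      qed
      then have "eventually (\<lambda>n. \<phi> n z = 0) sequentially"
        by (auto simp: eventually_sequentially)
      then show ?thesis using False by (simp add: tendsto_eventually)
    qed
    have conv: "(\<lambda>n. LINT z|Q. \<phi> n z) \<longlonglongrightarrow> measure Q C" if "finite_measure Q" "sets Q = sets borel" for Q
    proof -
      interpret Q: finite_measure Q by fact
      have [measurable_cong]: "sets Q = sets borel" by fact
      have [measurable]: "C \<in> sets borel" using C by (rule borel_closed)
      have [measurable]: "\<phi> n \<in> borel_measurable borel" for n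
        by (rule borel_measurable_continuous_onI[OF cont])
      have "(\<lambda>n. LINT z|Q. \<phi> n z) \<longlonglongrightarrow> (LINT z|Q. indicator C z)"
        by (rule integral_dominated_convergence[where w = "\<lambda>_. 1"]) (use lim bd in auto)
      moreover have "C \<inter> space Q = C"
        using sets_eq_imp_space_eq[OF that(2)] by simp
      ultimately show ?thesis by simp
    qed
    have "(LINT z|M. \<phi> n z) = (LINT z|N. \<phi> n z)" for n
      by (rule eq[OF cont]) (use bd in \<open>auto simp: bounded_iff\<close>)
    then have "measure M C = measure N C"
      using LIMSEQ_unique[OF conv[OF M]] conv[OF N] by simp
    then show ?thesis
      by (simp add: M.emeasure_eq_measure N.emeasure_eq_measure)
  qed
  then show "emeasure M C = emeasure N C" by (cases "C = {}") auto
qed (auto simp: Int_stable_def)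

section \<open>Haar measure on the closure of the orbit\<close>

lemma continuous_on_times_vec [continuous_intros]:
  fixes f g :: "'a::topological_space \<Rightarrow> complex ^ 'm"
  assumes "continuous_on S f" "continuous_on S g"
  shows "continuous_on S (\<lambda>x. f x * g x)"
  unfolding times_vec_def
  by (intro continuous_on_vec_lambda continuous_intros assms)

text \<open>
  Integrate the indicator of \<open>g * z \<in> A\<close> over \<open>(z, g)\<close> against the product of the two measures.
  Integrating over \<open>z\<close> first gives \<open>M A\<close>; integrating over \<open>g\<close> first gives \<open>N A\<close>, since the
  multiplication is commutative.
\<close>

lemma haar_prob_unique:
  fixes K :: "(complex ^ 'm) set"
  assumes M: "is_haar_prob K M" and N: "is_haar_prob K N"
    and K: "K \<in> sets borel" and mult: "\<And>g z. g \<in> K \<Longrightarrow> z \<in> K \<Longrightarrow> g * z \<in> K"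
  shows "M = N"
proof (rule measure_eqI)
  have sM [measurable_cong]: "sets M = sets (restrict_space borel K)"
    and sN [measurable_cong]: "sets N = sets (restrict_space borel K)"
    using M N by (auto simp: is_haar_prob_def)
  interpret M: prob_space M using M by (simp add: is_haar_prob_def)
  interpret N: prob_space N using N by (simp add: is_haar_prob_def)
  interpret pair_sigma_finite M N ..
  have spM: "space M = K" and spN: "space N = K"
    using sets_eq_imp_space_eq[OF sM] sets_eq_imp_space_eq[OF sN] by (auto simp: space_restrict_space)
  show "sets M = sets N" using sM sN by simp
  fix A assume A: "A \<in> sets M"
  then have [measurable]: "A \<in> sets (restrict_space borel K)" by (simp add: sM)
  have idM: "(\<lambda>z. z) \<in> borel_measurable M" and idN: "(\<lambda>z. z) \<in> borel_measurable N"
    unfolding measurable_cong_sets[OF sM refl] measurable_cong_sets[OF sN refl]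
    by (auto intro: measurable_restrict_space1)
  have "(\<lambda>p. fst p * snd p) \<in> borel_measurable (M \<Otimes>\<^sub>M N)"
    by (rule borel_measurable_continuous_Pair)
       (auto intro!: measurable_compose[OF measurable_fst idM] measurable_compose[OF measurable_snd idN]
          continuous_intros)
  then have mm [measurable]: "(\<lambda>p. fst p * snd p) \<in> measurable (M \<Otimes>\<^sub>M N) (restrict_space borel K)"
    by (rule measurable_restrict_space2[rotated]) (auto simp: space_pair_measure spM spN mult)
  have inv: "(\<integral>\<^sup>+z. indicator A (g * z) \<partial>Q) = emeasure Q A"
    if Q: "is_haar_prob K Q" and g: "g \<in> K" for Q g
  proof -
    have sQ [measurable_cong]: "sets Q = sets (restrict_space borel K)"
      using Q by (auto simp: is_haar_prob_def)
    have spQ: "space Q = K"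
      using sets_eq_imp_space_eq[OF sQ] by (auto simp: space_restrict_space)
    have m: "(\<lambda>z. g * z) \<in> measurable Q Q"
      unfolding measurable_cong_sets[OF sQ sQ]
      by (intro measurable_restrict_space2 measurable_restrict_space1 borel_measurable_continuous_onI
            continuous_intros) (auto simp: space_restrict_space mult g)
    have "emeasure Q A = emeasure (distr Q Q (\<lambda>z. g * z)) A"
      using Q g by (simp add: is_haar_prob_def)
    also have "\<dots> = (\<integral>\<^sup>+z. indicator A z \<partial>distr Q Q (\<lambda>z. g * z))"
      by (simp add: sQ)
    also have "\<dots> = (\<integral>\<^sup>+z. indicator A (g * z) \<partial>Q)"
      by (rule nn_integral_distr[OF m]) simp
    finally show ?thesis ..
  qed
  have "emeasure M A = (\<integral>\<^sup>+g. (\<integral>\<^sup>+z. indicator A (g * z) \<partial>M) \<partial>N)"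
    by (subst nn_integral_cong[OF inv[OF M]]) (auto simp: N.emeasure_space_1[unfolded spN] spN)
  also have "\<dots> = (\<integral>\<^sup>+g. (\<integral>\<^sup>+z. indicator A (z * g) \<partial>M) \<partial>N)"
    by (simp add: mult.commute)
  also have "\<dots> = (\<integral>\<^sup>+z. (\<integral>\<^sup>+g. indicator A (z * g) \<partial>N) \<partial>M)"
    by (rule Fubini') (simp add: case_prod_beta)
  also have "\<dots> = emeasure N A"
    by (subst nn_integral_cong[OF inv[OF N]]) (auto simp: M.emeasure_space_1[unfolded spM] spM)
  finally show "emeasure M A = emeasure N A" .
qed

lemma Psi_Theta_nth: "Psi_Theta \<theta> n $ j = cis (of_int n * \<theta> $ j)"
  by (simp add: Psi_Theta_def cis_conv_exp mult_ac)

lemma Psi_Theta_add: "Psi_Theta \<theta> (m + n) = Psi_Theta \<theta> m * Psi_Theta \<theta> n"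
  by (simp add: vec_eq_iff Psi_Theta_nth cis_mult distrib_right)

lemma Psi_Theta_0: "Psi_Theta \<theta> 0 = 1"
  by (simp add: vec_eq_iff Psi_Theta_nth)

lemma Psi_Theta_in_G: "Psi_Theta \<theta> n \<in> G_Theta \<theta>"
  unfolding G_Theta_def by (rule subsetD[OF closure_subset]) simp

lemma closed_G_Theta: "closed (G_Theta \<theta>)"
  by (simp add: G_Theta_def)

lemma G_Theta_minimal:
  assumes "closed S" "\<And>n. Psi_Theta \<theta> n \<in> S"
  shows "G_Theta \<theta> \<subseteq> S"
  unfolding G_Theta_def using assms by (intro closure_minimal) auto

lemma norm_G_Theta_nth:
  assumes "z \<in> G_Theta \<theta>"
  shows "norm (z $ j) = 1"
proof -
  have "G_Theta \<theta> \<subseteq> {z. norm (z $ j) = 1}"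
    by (intro G_Theta_minimal closed_Collect_eq continuous_intros) (simp add: Psi_Theta_nth)
  with assms show ?thesis by auto
qed

lemma compact_G_Theta: "compact (G_Theta (\<theta> :: real ^ 'm))"
proof -
  have "norm z \<le> (\<Sum>j\<in>(UNIV :: 'm set). 1)" if "z \<in> G_Theta \<theta>" for z
    unfolding norm_vec_def
    by (rule order.trans[OF L2_set_le_sum]) (simp_all add: norm_G_Theta_nth[OF that])
  then have "bounded (G_Theta \<theta>)" unfolding bounded_iff by blast
  then show ?thesis by (simp add: compact_eq_bounded_closed closed_G_Theta)
qed

text \<open>
  The closure argument is applied to one factor at a time: first \<open>\<Psi>(n) * z\<close> with \<open>z \<in> G\<close>, then
  \<open>g * z\<close> with \<open>g \<in> G\<close>.
\<close>

lemma mult_G_Theta: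
  assumes "g \<in> G_Theta \<theta>" "z \<in> G_Theta \<theta>"
  shows "g * z \<in> G_Theta \<theta>"
proof -
  have clos: "closed {z. z * w \<in> G_Theta \<theta>}" for w
  proof -
    have "closed ((\<lambda>z. z * w) -` G_Theta \<theta>)"
      by (intro closed_vimage closed_G_Theta continuous_intros)
    then show ?thesis by (simp add: vimage_def)
  qed
  have "G_Theta \<theta> \<subseteq> {z. z * Psi_Theta \<theta> n \<in> G_Theta \<theta>}" for n
    by (rule G_Theta_minimal[OF clos]) (simp add: Psi_Theta_add[symmetric] Psi_Theta_in_G)
  then have "Psi_Theta \<theta> n * z \<in> G_Theta \<theta>" for n
    using assms(2) by (auto simp: mult.commute)
  then have "G_Theta \<theta> \<subseteq> {g. g * z \<in> G_Theta \<theta>}"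
    by (intro G_Theta_minimal[OF clos]) simp
  with assms(1) show ?thesis by auto
qed

lemma (in invariant_mean) shift_by:
  assumes "bounded (range f)"
  shows "L (\<lambda>n. f (n + k)) = L f"
proof (induction k)
  case (Suc k)
  have "bounded (range (\<lambda>n. f (n + k)))"
    using assms by (rule bounded_subset) auto
  from shift[OF this] Suc show ?case by simp
qed simp

text \<open>
  The measure representing \<open>L\<close> along \<open>\<Psi>(n)\<close> has integrals invariant under \<open>\<Psi>(1)\<close> by shift
  invariance, hence under every \<open>\<Psi>(n)\<close>, and under all of \<open>G\<close> by dominated convergence.
\<close>

lemma (in invariant_mean) haar_measure:
  fixes \<theta> :: "real ^ 'm"
  obtains M where "is_haar_prob (G_Theta \<theta>) M"
    "\<And>\<phi> :: complex ^ 'm \<Rightarrow> real. continuous_on UNIV \<phi> \<Longrightarrow>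
       (LINT z|M. \<phi> z) = L (\<lambda>n. \<phi> (Psi_Theta \<theta> (int n)))"
proof -
  let ?G = "G_Theta \<theta>" and ?x = "\<lambda>n. Psi_Theta \<theta> (int n)"
  obtain N where "prob_space N" and sN: "sets N = sets borel" and NG: "AE z in N. z \<in> ?G"
    and NL: "\<And>\<phi> :: complex ^ 'm \<Rightarrow> real. continuous_on UNIV \<phi> \<Longrightarrow> (LINT z|N. \<phi> z) = L (\<lambda>n. \<phi> (?x n))"
    by (rule representing_measure[of ?G ?x, OF compact_G_Theta Psi_Theta_in_G]) (rule that, assumption+)
  interpret N: prob_space N by fact
  note [measurable_cong] = sN
  have spN: "space N = UNIV" using sets_eq_imp_space_eq[OF sN] by simp
  have Gb [measurable]: "?G \<in> sets borel" by (rule borel_closed[OF closed_G_Theta])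
  have bdG: "\<exists>B. \<forall>z\<in>?G. \<bar>\<phi> z\<bar> \<le> B" if "continuous_on UNIV \<phi>" for \<phi> :: "complex ^ 'm \<Rightarrow> real"
    using compact_imp_bounded[OF compact_continuous_image[OF continuous_on_subset[OF that] compact_G_Theta], of \<theta>]
    by (auto simp: bounded_iff)
  have pos: "(LINT z|N. \<phi> (Psi_Theta \<theta> (int k) * z)) = (LINT z|N. \<phi> z)"
    if \<phi>: "continuous_on UNIV \<phi>" for \<phi> :: "complex ^ 'm \<Rightarrow> real" and k
  proof -
    have "continuous_on UNIV (\<lambda>z. \<phi> (Psi_Theta \<theta> (int k) * z))"
      by (intro continuous_on_compose2[OF \<phi>] continuous_intros) auto
    then have "(LINT z|N. \<phi> (Psi_Theta \<theta> (int k) * z)) = L (\<lambda>n. \<phi> (Psi_Theta \<theta> (int k) * ?x n))"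
      by (rule NL)
    also have "\<dots> = L (\<lambda>n. \<phi> (?x (n + k)))"
      by (simp add: Psi_Theta_add mult.commute)
    also have "\<dots> = L (\<lambda>n. \<phi> (?x n))"
      by (rule shift_by) (use bdG[OF \<phi>] Psi_Theta_in_G in \<open>auto simp: bounded_iff\<close>)
    finally show ?thesis by (simp add: NL[OF \<phi>])
  qed
  \<comment> \<open>For negative \<open>n\<close>, invariance under \<open>\<Psi>(- n)\<close> is applied to the translated function.\<close>
  have all: "(LINT z|N. \<phi> (Psi_Theta \<theta> n * z)) = (LINT z|N. \<phi> z)"
    if \<phi>: "continuous_on UNIV \<phi>" for \<phi> :: "complex ^ 'm \<Rightarrow> real" and n
  proof (cases "0 \<le> n")
    case True
    then show ?thesis using pos[OF \<phi>, of "nat n"] by simp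
  next
    case False
    have "continuous_on UNIV (\<lambda>z. \<phi> (Psi_Theta \<theta> n * z))"
      by (intro continuous_on_compose2[OF \<phi>] continuous_intros) auto
    from pos[OF this, of "nat (- n)"] False
    show ?thesis
      by (simp add: mult.assoc[symmetric] Psi_Theta_add[symmetric] Psi_Theta_0)
  qed
  have inv: "(LINT z|N. \<phi> (g * z)) = (LINT z|N. \<phi> z)"
    if \<phi>: "continuous_on UNIV \<phi>" and g: "g \<in> ?G" for \<phi> :: "complex ^ 'm \<Rightarrow> real" and g
  proof -
    obtain s where s: "\<And>n. s n \<in> range (Psi_Theta \<theta>)" "s \<longlonglongrightarrow> g"
      using g unfolding G_Theta_def closure_sequential by blast
    obtain B where B: "\<And>z. z \<in> ?G \<Longrightarrow> \<bar>\<phi> z\<bar> \<le> B" using bdG[OF \<phi>] by blast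
    have [measurable]: "(\<lambda>z. \<phi> (g * z)) \<in> borel_measurable N" for g
      unfolding measurable_cong_sets[OF sN refl]
      by (intro borel_measurable_continuous_onI continuous_on_compose2[OF \<phi>] continuous_intros) auto
    have "(\<lambda>n. LINT z|N. \<phi> (s n * z)) \<longlonglongrightarrow> (LINT z|N. \<phi> (g * z))"
    proof (rule integral_dominated_convergence[where w = "\<lambda>_. B"])
      have "(\<lambda>n. \<phi> (s n * z)) \<longlonglongrightarrow> \<phi> (g * z)" for z
      proof -
        have "continuous_on UNIV (\<lambda>g. \<phi> (g * z))"
          by (intro continuous_on_compose2[OF \<phi>] continuous_intros) auto
        then show ?thesis by (rule continuous_on_tendsto_compose[OF _ s(2)]) auto
      qed
      then show "AE z in N. (\<lambda>n. \<phi> (s n * z)) \<longlonglongrightarrow> \<phi> (g * z)" by simp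
      fix n
      have sG: "s n \<in> ?G" using s(1)[of n] by (auto simp: Psi_Theta_in_G)
      show "AE z in N. norm (\<phi> (s n * z)) \<le> B"
        using NG by eventually_elim (auto intro: B mult_G_Theta[OF sG])
    qed auto
    moreover have "(LINT z|N. \<phi> (s n * z)) = (LINT z|N. \<phi> z)" for n
      using s(1)[of n] all[OF \<phi>] by auto
    ultimately show ?thesis by (simp add: tendsto_const_iff)
  qed
  have mg [measurable]: "(\<lambda>z. g * z) \<in> borel_measurable N" for g :: "complex ^ 'm"
    unfolding measurable_cong_sets[OF sN refl]
    by (intro borel_measurable_continuous_onI continuous_intros)
  have distrN: "distr N borel (\<lambda>z. g * z) = N" if "g \<in> ?G" for g
  proof (rule measure_eqI_continuous_integrals)
    interpret D: prob_space "distr N borel (\<lambda>z. g * z)" by (rule N.prob_space_distr[OF mg])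
    show "finite_measure (distr N borel (\<lambda>z. g * z))" by (rule D.finite_measure_axioms)
    show "finite_measure N" by (rule N.finite_measure_axioms)
    fix \<phi> :: "complex ^ 'm \<Rightarrow> real" assume \<phi>: "continuous_on UNIV \<phi>"
    have "(LINT z|distr N borel (\<lambda>z. g * z). \<phi> z) = (LINT z|N. \<phi> (g * z))"
      by (rule integral_distr[OF mg borel_measurable_continuous_onI[OF \<phi>]])
    also have "\<dots> = (LINT z|N. \<phi> z)" by (rule inv[OF \<phi> that])
    finally show "(LINT z|distr N borel (\<lambda>z. g * z). \<phi> z) = (LINT z|N. \<phi> z)" .
  qed (simp_all add: sN)
  define M where "M = restrict_space N ?G"
  have sM: "sets M = sets (restrict_space borel ?G)"
    unfolding M_def by (rule sets_restrict_space_cong[OF sN])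
  have spM: "space M = ?G" by (simp add: M_def space_restrict_space spN)
  have emM: "emeasure M A = emeasure N A" if "A \<subseteq> ?G" for A
    unfolding M_def by (rule emeasure_restrict_space) (use that sN spN in auto)
  have subM: "A \<subseteq> ?G" "A \<in> sets borel" if "A \<in> sets M" for A
    using that Gb by (auto simp: sM sets_restrict_space)
  have emG: "emeasure N ?G = 1"
    using NG N.emeasure_eq_1_AE[of ?G] by (simp add: sN)
  show thesis
  proof
    show "is_haar_prob ?G M"
      unfolding is_haar_prob_def
    proof (intro conjI ballI sM)
      show "prob_space M"
        unfolding M_def by (rule prob_space_restrict_space) (simp_all add: sN emG)
      fix g assume g: "g \<in> ?G"
      have m: "(\<lambda>z. g * z) \<in> measurable M M"
        unfolding measurable_cong_sets[OF sM sM]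
        by (intro measurable_restrict_space2 measurable_restrict_space1 borel_measurable_continuous_onI
            continuous_intros) (auto simp: space_restrict_space mult_G_Theta g)
      show "distr M M (\<lambda>z. g * z) = M"
      proof (rule measure_eqI)
        fix A assume "A \<in> sets (distr M M (\<lambda>z. g * z))"
        then have A: "A \<in> sets M" by simp
        note [measurable] = subM(2)[OF A]
        have "emeasure (distr M M (\<lambda>z. g * z)) A = emeasure N ((\<lambda>z. g * z) -` A \<inter> ?G)"
          using A by (simp add: emeasure_distr[OF m] spM emM)
        also have "\<dots> = emeasure N ((\<lambda>z. g * z) -` A \<inter> space N)"
        proof (rule emeasure_eq_AE)
          show "AE z in N. (z \<in> (\<lambda>z. g * z) -` A \<inter> ?G) = (z \<in> (\<lambda>z. g * z) -` A \<inter> space N)"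
            using NG by eventually_elim (simp add: spN)
          show "(\<lambda>z. g * z) -` A \<inter> space N \<in> sets N" by measurable
          then show "(\<lambda>z. g * z) -` A \<inter> ?G \<in> sets N"
            using Gb by (simp add: spN sN)
        qed
        also have "\<dots> = emeasure (distr N borel (\<lambda>z. g * z)) A"
          by (rule emeasure_distr[symmetric]) measurable
        also have "\<dots> = emeasure M A"
          using distrN[OF g] by (simp add: emM subM(1)[OF A])
        finally show "emeasure (distr M M (\<lambda>z. g * z)) A = emeasure M A" .
      qed simp
    qed
    fix \<phi> :: "complex ^ 'm \<Rightarrow> real" assume \<phi>: "continuous_on UNIV \<phi>"
    have m\<phi>: "\<phi> \<in> borel_measurable N"
      unfolding measurable_cong_sets[OF sN refl] by (rule borel_measurable_continuous_onI[OF \<phi>])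
    have "(LINT z|M. \<phi> z) = (LINT z|N. indicator ?G z *\<^sub>R \<phi> z)"
      unfolding M_def by (rule integral_restrict_space) (simp add: sN spN)
    also have "\<dots> = (LINT z|N. \<phi> z)"
    proof (rule integral_cong_AE)
      show "(\<lambda>z. indicator ?G z *\<^sub>R \<phi> z) \<in> borel_measurable N"
        using m\<phi> by (intro borel_measurable_scaleR borel_measurable_indicator) (simp_all add: sN)
      show "AE z in N. indicator ?G z *\<^sub>R \<phi> z = \<phi> z"
        using NG by eventually_elim simp
    qed (rule m\<phi>)
    also have "\<dots> = L (\<lambda>n. \<phi> (?x n))" by (rule NL[OF \<phi>])
    finally show "(LINT z|M. \<phi> z) = L (\<lambda>n. \<phi> (?x n))" .
  qed
qed

lemma haar_prob_eqI:
  assumes "is_haar_prob (G_Theta \<theta>) M"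
  shows "haar_prob (G_Theta \<theta>) = M"
  unfolding haar_prob_def
proof (rule the_equality)
  fix N assume "is_haar_prob (G_Theta \<theta>) N"
  then show "N = M"
    by (rule haar_prob_unique[OF _ assms borel_closed[OF closed_G_Theta]]) (rule mult_G_Theta)
qed (rule assms)

lemma (in invariant_mean) eq_haar_integral:
  fixes \<phi> :: "complex ^ 'm \<Rightarrow> real"
  assumes "continuous_on UNIV \<phi>"
  shows "L (\<lambda>n. \<phi> (Psi_Theta \<theta> (int n))) = (LINT z|haar_prob (G_Theta \<theta>). \<phi> z)"
proof -
  obtain M where M: "is_haar_prob (G_Theta \<theta>) M"
    and L: "\<And>\<phi> :: complex ^ 'm \<Rightarrow> real. continuous_on UNIV \<phi> \<Longrightarrow>
       (LINT z|M. \<phi> z) = L (\<lambda>n. \<phi> (Psi_Theta \<theta> (int n)))"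
    by (rule haar_measure[of \<theta>]) (rule that, assumption+)
  have "haar_prob (G_Theta \<theta>) = M" by (rule haar_prob_eqI[OF M])
  then show ?thesis using L[OF assms] by simp
qed

lemma is_haar_prob_haar_prob: "is_haar_prob (G_Theta \<theta>) (haar_prob (G_Theta \<theta>))"
proof -
  obtain L where "invariant_mean L"
    by (rule abel_limit_mean[of "at_left 1"], simp, simp, rule that)
  then interpret invariant_mean L .
  obtain M where M: "is_haar_prob (G_Theta \<theta>) M"
    by (rule haar_measure[of \<theta>]) (rule that)
  then show ?thesis by (simp add: haar_prob_eqI)
qed

text \<open>
  If the Abel means stayed away from the integral along some \<open>r \<up> 1\<close>, then the mean obtained from
  the filter of these bad \<open>r\<close> would still be integration against the Haar measure, a contradiction.
\<close>

lemma equidistribution: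
  fixes \<phi> :: "complex ^ 'm \<Rightarrow> real"
  assumes \<phi>: "continuous_on UNIV \<phi>"
  shows "((\<lambda>r. abel_mean r (\<lambda>n. \<phi> (Psi_Theta \<theta> (int n)))) \<longlongrightarrow> (LINT z|haar_prob (G_Theta \<theta>). \<phi> z)) (at_left 1)"
    (is "(?A \<longlongrightarrow> ?I) _")
proof (rule tendstoI, rule ccontr)
  fix e :: real assume e: "0 < e" "\<not> (\<forall>\<^sub>F r in at_left 1. dist (?A r) ?I < e)"
  define F where "F = inf (at_left 1) (principal {r. \<not> dist (?A r) ?I < e})"
  have "F \<noteq> bot"
    using e(2) by (simp add: F_def trivial_limit_def eventually_inf_principal)
  have "F \<le> at_left 1" by (simp add: F_def)
  obtain F' L where F': "F' \<noteq> bot" "F' \<le> F" and L: "invariant_mean L"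
    and lim: "\<And>f. bounded (range f) \<Longrightarrow> ((\<lambda>r. abel_mean r f) \<longlongrightarrow> L f) F'"
    by (rule abel_limit_mean[OF \<open>F \<noteq> bot\<close> \<open>F \<le> at_left 1\<close>]) (rule that, assumption+)
  have "bounded (\<phi> ` G_Theta \<theta>)"
    using compact_continuous_image[OF continuous_on_subset[OF \<phi>] compact_G_Theta] compact_imp_bounded by blast
  then have "bounded (range (\<lambda>n. \<phi> (Psi_Theta \<theta> (int n))))"
    by (rule bounded_subset) (auto intro: Psi_Theta_in_G)
  from lim[OF this] have "(?A \<longlongrightarrow> ?I) F'"
    by (simp add: invariant_mean.eq_haar_integral[OF L \<phi>])
  then have "\<forall>\<^sub>F r in F'. dist (?A r) ?I < e" using e(1) by (rule tendstoD)
  moreover have "\<forall>\<^sub>F r in F'. \<not> dist (?A r) ?I < e"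
    by (rule filter_leD[OF F'(2)]) (simp add: F_def eventually_inf_principal)
  ultimately have "\<forall>\<^sub>F r in F'. False" by eventually_elim simp
  with F'(1) show False by (simp add: trivial_limit_def)
qed

section \<open>Integration over the orbit closure\<close>

abbreviation haar_Theta :: "real ^ 'm \<Rightarrow> (complex ^ 'm) measure" where
  "haar_Theta \<theta> \<equiv> haar_prob (G_Theta \<theta>)"

lemma sets_haar_Theta: "sets (haar_Theta \<theta>) = sets (restrict_space borel (G_Theta \<theta>))"
  using is_haar_prob_haar_prob[of \<theta>] by (simp add: is_haar_prob_def)

lemma space_haar_Theta: "space (haar_Theta \<theta>) = G_Theta \<theta>"
  using sets_eq_imp_space_eq[OF sets_haar_Theta] by (simp add: space_restrict_space)

lemma prob_space_haar_Theta: "prob_space (haar_Theta \<theta>)"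
  using is_haar_prob_haar_prob[of \<theta>] by (simp add: is_haar_prob_def)

lemma measurable_haar_Theta:
  "continuous_on UNIV f \<Longrightarrow> f \<in> borel_measurable (haar_Theta \<theta>)"
  unfolding measurable_cong_sets[OF sets_haar_Theta refl]
  by (intro measurable_restrict_space1 borel_measurable_continuous_onI)

lemma bounded_image_G_Theta:
  fixes f :: "complex ^ 'm \<Rightarrow> 'b::real_normed_vector"
  assumes "continuous_on UNIV f"
  shows "bounded (f ` G_Theta \<theta>)"
  by (rule compact_imp_bounded, rule compact_continuous_image[OF _ compact_G_Theta])
     (rule continuous_on_subset[OF assms], simp)

lemma bounded_range_G_Theta:
  fixes f :: "complex ^ 'm \<Rightarrow> 'b::real_normed_vector"
  assumes "continuous_on UNIV f"
  shows "bounded (range (\<lambda>n :: nat. f (Psi_Theta \<theta> (int n))))"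
  by (rule bounded_subset[OF bounded_image_G_Theta[OF assms, of \<theta>]]) (auto intro: Psi_Theta_in_G)

lemma integrable_haar_Theta:
  fixes f :: "complex ^ 'm \<Rightarrow> 'b::{banach, second_countable_topology}"
  assumes "continuous_on UNIV f"
  shows "integrable (haar_Theta \<theta>) f"
proof -
  interpret prob_space "haar_Theta \<theta>" by (rule prob_space_haar_Theta)
  obtain B where "\<And>z. z \<in> G_Theta \<theta> \<Longrightarrow> norm (f z) \<le> B"
    using bounded_image_G_Theta[OF assms, of \<theta>] by (auto simp: bounded_iff)
  then have "AE z in haar_Theta \<theta>. norm (f z) \<le> B"
    by (intro AE_I2) (simp add: space_haar_Theta)
  then show ?thesis
    by (rule integrable_const_bound[OF _ measurable_haar_Theta[OF assms]])
qed

text \<open>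
  Translation by \<open>\<Psi>(1)\<close> multiplies \<open>\<integral> z\<^sub>i cnj z\<^sub>j dm\<close> by \<open>cis (\<theta>\<^sub>i - \<theta>\<^sub>j)\<close>, which differs from 1 for
  \<open>i \<noteq> j\<close> because the phases are distinct.
\<close>

lemma characters_orthonormal:
  fixes \<theta> :: "real ^ 'm"
  assumes "distinct_phases \<theta>"
  shows "(LINT z|haar_Theta \<theta>. z $ i * cnj (z $ j)) = (if i = j then 1 else 0)"
proof (cases "i = j")
  case True
  interpret prob_space "haar_Theta \<theta>" by (rule prob_space_haar_Theta)
  have "(LINT z|haar_Theta \<theta>. z $ i * cnj (z $ j)) = (LINT z|haar_Theta \<theta>. 1)"
    by (rule Bochner_Integration.integral_cong)
       (simp_all add: True space_haar_Theta complex_norm_square[symmetric] norm_G_Theta_nth)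
  then show ?thesis using True prob_space by simp
next
  case False
  let ?\<chi> = "\<lambda>z :: complex ^ 'm. z $ i * cnj (z $ j)"
  define g where "g = Psi_Theta \<theta> 1"
  have cont: "continuous_on UNIV ?\<chi>" by (intro continuous_intros)
  have m: "(\<lambda>z. g * z) \<in> measurable (haar_Theta \<theta>) (haar_Theta \<theta>)"
    unfolding measurable_cong_sets[OF sets_haar_Theta sets_haar_Theta]
    by (intro measurable_restrict_space2 measurable_restrict_space1 borel_measurable_continuous_onI
        continuous_intros) (auto simp: space_restrict_space g_def mult_G_Theta Psi_Theta_in_G)
  have "distr (haar_Theta \<theta>) (haar_Theta \<theta>) (\<lambda>z. g * z) = haar_Theta \<theta>"
    using is_haar_prob_haar_prob[of \<theta>] by (simp add: is_haar_prob_def g_def Psi_Theta_in_G)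
  then have "(LINT z|haar_Theta \<theta>. ?\<chi> z) = (LINT z|distr (haar_Theta \<theta>) (haar_Theta \<theta>) (\<lambda>z. g * z). ?\<chi> z)"
    by simp
  also have "\<dots> = (LINT z|haar_Theta \<theta>. ?\<chi> (g * z))"
    by (rule integral_distr[OF m measurable_haar_Theta[OF cont]])
  also have "\<dots> = (LINT z|haar_Theta \<theta>. ?\<chi> g * ?\<chi> z)"
    by (simp add: mult_ac)
  also have "\<dots> = ?\<chi> g * (LINT z|haar_Theta \<theta>. ?\<chi> z)"
    by simp
  finally have eq: "(1 - ?\<chi> g) * (LINT z|haar_Theta \<theta>. ?\<chi> z) = 0"
    by (simp add: algebra_simps)
  have "?\<chi> g \<noteq> 1"
  proof
    assume "?\<chi> g = 1"
    then have "cis (\<theta> $ i - \<theta> $ j) = 1"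
      by (simp add: g_def Psi_Theta_nth cis_cnj cis_mult)
    then obtain n :: int where "\<theta> $ i - \<theta> $ j = of_int (2 * n) * pi"
      by (auto simp: cis_conv_exp exp_eq_1)
    then have "\<theta> $ i = \<theta> $ j + of_int n * (2 * pi)" by simp
    then have "[\<theta> $ j = \<theta> $ i] (rmod (2 * pi))"
      unfolding rcong_altdef by blast
    with assms False show False
      by (auto simp: distinct_phases_def)
  qed
  with eq False show ?thesis by simp
qed

lemma equidistribution_complex:
  fixes \<psi> :: "complex ^ 'm \<Rightarrow> complex"
  assumes \<psi>: "continuous_on UNIV \<psi>"
  shows "((\<lambda>r. of_real (1 - r) * (\<Sum>n. \<psi> (Psi_Theta \<theta> (int n)) * of_real r ^ n))
           \<longlongrightarrow> (LINT z|haar_Theta \<theta>. \<psi> z)) (at_left 1)"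
proof (rule Lim_transform_eventually)
  have re: "continuous_on UNIV (\<lambda>z. Re (\<psi> z))" and im: "continuous_on UNIV (\<lambda>z. Im (\<psi> z))"
    using \<psi> by (intro continuous_intros; assumption)+
  let ?A = "\<lambda>\<phi> r. abel_mean r (\<lambda>n. \<phi> (Psi_Theta \<theta> (int n)))"
  have "((\<lambda>r. Complex (?A (\<lambda>z. Re (\<psi> z)) r) (?A (\<lambda>z. Im (\<psi> z)) r))
      \<longlongrightarrow> Complex (LINT z|haar_Theta \<theta>. Re (\<psi> z)) (LINT z|haar_Theta \<theta>. Im (\<psi> z))) (at_left 1)"
    by (intro tendsto_Complex equidistribution re im)
  also have "Complex (LINT z|haar_Theta \<theta>. Re (\<psi> z)) (LINT z|haar_Theta \<theta>. Im (\<psi> z))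
      = (LINT z|haar_Theta \<theta>. \<psi> z)"
    using integrable_haar_Theta[OF \<psi>, of \<theta>] by (simp add: complex_eq_iff)
  finally show "((\<lambda>r. Complex (?A (\<lambda>z. Re (\<psi> z)) r) (?A (\<lambda>z. Im (\<psi> z)) r))
      \<longlongrightarrow> (LINT z|haar_Theta \<theta>. \<psi> z)) (at_left 1)" .
  have "\<forall>\<^sub>F r in at_left (1::real). r \<in> {0<..<1}"
    by (rule eventually_at_leftI) auto
  then show "\<forall>\<^sub>F r in at_left 1. Complex (?A (\<lambda>z. Re (\<psi> z)) r) (?A (\<lambda>z. Im (\<psi> z)) r)
      = of_real (1 - r) * (\<Sum>n. \<psi> (Psi_Theta \<theta> (int n)) * of_real r ^ n)"
  proof eventually_elim
    case (elim r)
    then have s: "summable (\<lambda>n. \<psi> (Psi_Theta \<theta> (int n)) * of_real r ^ n)"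
      by (intro summable_bounded_power(2) bounded_range_G_Theta \<psi>) auto
    have "Re w * r ^ n = Re (w * of_real r ^ n)" "Im w * r ^ n = Im (w * of_real r ^ n)" for w n
      by (simp_all flip: of_real_power)
    then show ?case
      by (simp add: abel_mean_def complex_eq_iff Re_suminf[OF s] Im_suminf[OF s])
  qed
qed

section \<open>Duality for prescribed coefficients\<close>

text \<open>
  Let \<open>T g\<close> be the coefficient vector of \<open>g\<close>, and \<open>C\<close> the set of continuous functions bounded by
  \<open>A\<close> on \<open>G\<close>. The set \<open>T ` C\<close> is convex. A hyperplane strictly separating \<open>a\<close> from its closure
  has a normal vector \<open>b\<close>, for which \<open>b \<bullet> T g = Re \<integral>g p dm\<close> with \<open>p = \<Sum>\<^sub>j cnj b\<^sub>j cnj z\<^sub>j\<close>. These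
  values come arbitrarily close to \<open>- A \<integral>\<bar>p\<bar> dm\<close>, while the hypothesis gives
  \<open>b \<bullet> a \<ge> - A \<integral>\<bar>p\<bar> dm\<close>. So \<open>a\<close> lies in the closure; orthonormality of the characters
  then removes the remaining small discrepancy at the cost of \<open>\<epsilon>\<close>.
\<close>

lemma bounded_coefficients_imp_continuous:
  fixes \<theta> :: "real ^ 'm" and a :: "complex ^ 'm"
  assumes dist: "distinct_phases \<theta>" and "0 \<le> A" "0 < \<epsilon>"
    and bound: "\<And>c :: 'm \<Rightarrow> complex. norm (\<Sum>j\<in>UNIV. c j * a $ j)
       \<le> A * (LINT z|haar_Theta \<theta>. norm (\<Sum>j\<in>UNIV. c j * cnj (z $ j)))"
  obtains g where "continuous_on UNIV g" "\<And>z. z \<in> G_Theta \<theta> \<Longrightarrow> norm (g z) \<le> A + \<epsilon>"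
    "\<And>j. (LINT z|haar_Theta \<theta>. g z * cnj (z $ j)) = a $ j"
proof -
  interpret prob_space "haar_Theta \<theta>" by (rule prob_space_haar_Theta)
  note int = integrable_haar_Theta[of _ \<theta>]
  define T :: "(complex ^ 'm \<Rightarrow> complex) \<Rightarrow> complex ^ 'm"
    where "T g = (\<chi> j. LINT z|haar_Theta \<theta>. g z * cnj (z $ j))" for g
  define C :: "(complex ^ 'm \<Rightarrow> complex) set"
    where "C = {g. continuous_on UNIV g \<and> (\<forall>z\<in>G_Theta \<theta>. norm (g z) \<le> A)}"
  have "convex (T ` C)"
  proof (rule convexI, safe)
    fix g h and u v :: real
    assume gh: "g \<in> C" "h \<in> C" and uv: "0 \<le> u" "0 \<le> v" "u + v = 1"
    have c: "continuous_on UNIV g" "continuous_on UNIV h" using gh by (auto simp: C_def)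
    define k where "k z = u *\<^sub>R g z + v *\<^sub>R h z" for z
    have "norm (k z) \<le> A" if "z \<in> G_Theta \<theta>" for z
    proof -
      have "norm (k z) \<le> u * norm (g z) + v * norm (h z)"
        unfolding k_def using uv by (intro order.trans[OF norm_triangle_ineq]) simp
      also have "\<dots> \<le> A"
        using gh that uv by (intro convex_bound_le) (auto simp: C_def)
      finally show ?thesis .
    qed
    moreover have "continuous_on UNIV k"
      unfolding k_def by (intro continuous_intros c)
    ultimately have "k \<in> C" by (simp add: C_def)
    moreover have "T k = u *\<^sub>R T g + v *\<^sub>R T h"
    proof -
      have "(LINT z|haar_Theta \<theta>. k z * cnj (z $ j))
          = (LINT z|haar_Theta \<theta>. u *\<^sub>R (g z * cnj (z $ j)) + v *\<^sub>R (h z * cnj (z $ j)))" for j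
        by (simp add: k_def algebra_simps)
      also have "\<dots> j = u *\<^sub>R (LINT z|haar_Theta \<theta>. g z * cnj (z $ j))
          + v *\<^sub>R (LINT z|haar_Theta \<theta>. h z * cnj (z $ j))" for j
        by (subst Bochner_Integration.integral_add) (auto intro!: int continuous_intros c)
      finally show ?thesis by (simp add: T_def vec_eq_iff)
    qed
    ultimately show "u *\<^sub>R T g + v *\<^sub>R T h \<in> T ` C" by (metis image_eqI)
  qed
  have "a \<in> closure (T ` C)"
  proof (rule ccontr)
    assume "a \<notin> closure (T ` C)"
    then obtain b \<beta> where b: "b \<bullet> a < \<beta>" and \<beta>: "\<And>s. s \<in> closure (T ` C) \<Longrightarrow> \<beta> < b \<bullet> s"
      using separating_hyperplane_closed_point[OF convex_closure[OF \<open>convex (T ` C)\<close>] closed_closure]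
      by metis
    define p where "p z = (\<Sum>j\<in>UNIV. cnj (b $ j) * cnj (z $ j))" for z :: "complex ^ 'm"
    define I where "I = (LINT z|haar_Theta \<theta>. norm (p z))"
    have contp: "continuous_on UNIV p" unfolding p_def by (intro continuous_intros)
    have inner_b: "b \<bullet> s = Re (\<Sum>j\<in>UNIV. cnj (b $ j) * s $ j)" for s
      by (simp add: inner_vec_def inner_complex_def)
    have "\<beta> \<le> - A * I"
    proof (rule field_le_epsilon)
      fix e :: real assume "0 < e"
      define \<delta> where "\<delta> = e / (A + 1)"
      have \<delta>: "0 < \<delta>" "A * \<delta> \<le> e"
        using \<open>0 < e\<close> \<open>0 \<le> A\<close> by (auto simp: \<delta>_def field_simps)
      have pos: "norm (p z) + \<delta> \<noteq> 0" for z using \<delta>(1) by (metis add_nonneg_pos less_irrefl norm_ge_zero)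
      \<comment> \<open>A continuous substitute for \<open>- A * cnj (sgn p)\<close>, the extremal function for the pairing with \<open>p\<close>.\<close>
      define g where "g z = - of_real (A / (norm (p z) + \<delta>)) * cnj (p z)" for z
      have cg: "continuous_on UNIV g"
        unfolding g_def by (intro continuous_intros contp) (simp add: pos)
      have "norm (g z) \<le> A" for z
      proof -
        have "norm (g z) = A * (norm (p z) / (norm (p z) + \<delta>))"
          using \<open>0 \<le> A\<close> \<delta>(1)
          by (simp add: g_def norm_mult abs_of_nonneg add_nonneg_nonneg del: of_real_divide of_real_add)
        also have "\<dots> \<le> A * 1"
          using \<open>0 \<le> A\<close> \<delta>(1) by (intro mult_left_mono) (auto simp: divide_le_eq_1 add_nonneg_pos)
        finally show ?thesis by simp
      qed
      then have "g \<in> C" using cg by (simp add: C_def)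
      then have "T g \<in> closure (T ` C)" by (intro subsetD[OF closure_subset] imageI)
      then have "\<beta> < b \<bullet> T g" by (rule \<beta>)
      also have "b \<bullet> T g = Re (LINT z|haar_Theta \<theta>. g z * p z)"
      proof -
        have "(LINT z|haar_Theta \<theta>. g z * p z)
            = (LINT z|haar_Theta \<theta>. (\<Sum>j\<in>UNIV. cnj (b $ j) * (g z * cnj (z $ j))))"
          by (simp add: p_def sum_distrib_left mult_ac)
        also have "\<dots> = (\<Sum>j\<in>UNIV. cnj (b $ j) * (LINT z|haar_Theta \<theta>. g z * cnj (z $ j)))"
          by (subst Bochner_Integration.integral_sum) (auto intro!: int continuous_intros cg)
        finally show ?thesis by (simp add: inner_b T_def)
      qed
      also have "\<dots> = (LINT z|haar_Theta \<theta>. Re (g z * p z))"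
        by (rule integral_Re[symmetric]) (intro int continuous_intros cg contp)
      also have "\<dots> \<le> (LINT z|haar_Theta \<theta>. - A * norm (p z) + A * \<delta>)"
      proof (rule integral_mono)
        show "integrable (haar_Theta \<theta>) (\<lambda>z. Re (g z * p z))"
          "integrable (haar_Theta \<theta>) (\<lambda>z. - A * norm (p z) + A * \<delta>)"
          by (intro int continuous_intros cg contp)+
        fix z
        let ?t = "norm (p z)"
        have "g z * p z = - of_real (A / (?t + \<delta>)) * (p z * cnj (p z))"
          by (simp only: g_def mult_ac)
        also have "\<dots> = of_real (- (A / (?t + \<delta>)) * ?t\<^sup>2)"
          by (simp only: complex_norm_square[symmetric] of_real_mult of_real_minus)
        finally have "Re (g z * p z) = - (A / (?t + \<delta>)) * ?t\<^sup>2"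
          by (simp only: Re_complex_of_real)
        also have "\<dots> = - (A * (?t\<^sup>2 / (?t + \<delta>)))" by simp
        also have "\<dots> \<le> - (A * (?t - \<delta>))"
        proof -
          have "(?t - \<delta>) * (?t + \<delta>) \<le> ?t\<^sup>2"
            by (simp add: algebra_simps power2_eq_square)
          then have "?t - \<delta> \<le> ?t\<^sup>2 / (?t + \<delta>)"
            using \<delta>(1) by (simp add: pos_le_divide_eq add_nonneg_pos)
          from mult_left_mono[OF this \<open>0 \<le> A\<close>] show ?thesis by simp
        qed
        finally show "Re (g z * p z) \<le> - A * ?t + A * \<delta>"
          by (simp add: algebra_simps)
      qed
      also have "\<dots> = - A * I + A * \<delta>"
        unfolding I_def
        by (subst Bochner_Integration.integral_add) (auto intro!: int continuous_intros contp simp: prob_space)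
      also have "\<dots> \<le> - A * I + e" using \<delta>(2) by simp
      finally show "\<beta> \<le> - A * I + e" by simp
    qed
    also have "- A * I \<le> b \<bullet> a"
      using bound[of "\<lambda>j. cnj (b $ j)"] abs_Re_le_cmod[of "\<Sum>j\<in>UNIV. cnj (b $ j) * a $ j"]
      by (simp add: inner_b I_def p_def)
    finally show False using b by simp
  qed
  \<comment> \<open>The correcting polynomial has \<open>CARD('m)\<close> terms of modulus at most \<open>\<eta>\<close>.\<close>
  define \<eta> where "\<eta> = \<epsilon> / real CARD('m)"
  have "0 < \<eta>" using \<open>0 < \<epsilon>\<close> by (simp add: \<eta>_def)
  obtain s where "s \<in> T ` C" "dist s a < \<eta>"
    using \<open>a \<in> closure (T ` C)\<close> \<open>0 < \<eta>\<close> unfolding closure_approachable by blast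
  then obtain h where h: "continuous_on UNIV h" "\<And>z. z \<in> G_Theta \<theta> \<Longrightarrow> norm (h z) \<le> A"
    and s: "s = T h" by (auto simp: C_def)
  define d where "d k = a $ k - s $ k" for k
  have d: "norm (d k) \<le> \<eta>" for k
  proof -
    have "norm (d k) \<le> norm (a - s)"
      using Finite_Cartesian_Product.norm_nth_le[of "a - s" k] by (simp add: d_def)
    also have "\<dots> \<le> \<eta>" using \<open>dist s a < \<eta>\<close> by (simp add: dist_norm norm_minus_commute)
    finally show ?thesis .
  qed
  define g where "g z = h z + (\<Sum>k\<in>UNIV. d k * z $ k)" for z
  show thesis
  proof
    show cg: "continuous_on UNIV g" unfolding g_def by (intro continuous_intros h)
    fix z assume z: "z \<in> G_Theta \<theta>"
    have "norm (\<Sum>k\<in>UNIV. d k * z $ k) \<le> (\<Sum>k\<in>(UNIV :: 'm set). \<eta>)"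
      by (rule sum_norm_le) (simp add: norm_mult norm_G_Theta_nth[OF z] d)
    also have "\<dots> = \<epsilon>" by (simp add: \<eta>_def)
    finally show "norm (g z) \<le> A + \<epsilon>"
      unfolding g_def using h(2)[OF z] by (intro order.trans[OF norm_triangle_ineq] add_mono)
  next
    fix j
    have "(LINT z|haar_Theta \<theta>. g z * cnj (z $ j))
        = (LINT z|haar_Theta \<theta>. h z * cnj (z $ j) + (\<Sum>k\<in>UNIV. d k * (z $ k * cnj (z $ j))))"
      by (simp add: g_def distrib_right sum_distrib_right mult.assoc)
    also have "\<dots> = (LINT z|haar_Theta \<theta>. h z * cnj (z $ j))
        + (\<Sum>k\<in>UNIV. d k * (LINT z|haar_Theta \<theta>. z $ k * cnj (z $ j)))"
      by (subst Bochner_Integration.integral_add, (intro int continuous_intros h)+,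
          subst Bochner_Integration.integral_sum) (auto intro!: int continuous_intros)
    also have "\<dots> = s $ j + d j"
      by (simp add: characters_orthonormal[OF dist] s T_def if_distrib cong: if_cong)
    finally show "(LINT z|haar_Theta \<theta>. g z * cnj (z $ j)) = a $ j" by (simp add: d_def)
  qed
qed

section \<open>Sequences with prescribed Abel coefficients\<close>

lemma cnj_Psi_Theta_nth:
  "cnj (Psi_Theta \<theta> (int n) $ j) = exp (- (\<i> * of_nat n * of_real (\<theta> $ j)))"
  by (simp add: Psi_Theta_def exp_cnj)

lemma abel_mean_finite_support:
  assumes "\<And>n. n \<ge> n0 \<Longrightarrow> f n = 0"
  shows "((\<lambda>r. abel_mean r f) \<longlongrightarrow> 0) (at_left 1)"
proof -
  have "(\<lambda>r. abel_mean r f) = (\<lambda>r. (1 - r) * (\<Sum>n<n0. f n * r ^ n))"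
    unfolding abel_mean_def using assms by (intro ext arg_cong2[where f = "(*)"] suminf_finite) auto
  moreover have "((\<lambda>r. (1 - r) * (\<Sum>n<n0. f n * r ^ n)) \<longlongrightarrow> (1 - 1) * (\<Sum>n<n0. f n * 1 ^ n)) (at_left 1)"
    by (intro tendsto_intros)
  ultimately show ?thesis by simp
qed

text \<open>
  By definition of \<open>A_inf\<close>, \<open>\<bar>F\<^sub>n\<bar> \<le> B + e\<^sub>n\<close> with \<open>e\<close> of finite support, so that \<open>e\<close> contributes
  nothing to the Abel means in the limit, and equidistribution evaluates the main term.
\<close>

lemma abel_coefficients_bounded:
  fixes \<theta> :: "real ^ 'm" and a :: "complex ^ 'm" and c :: "'m \<Rightarrow> complex"
  assumes coeff: "\<And>j. has_abel_coeff F (\<theta> $ j) (a $ j)"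
    and A: "A_inf F < ennreal B"
  shows "norm (\<Sum>j\<in>UNIV. c j * a $ j) \<le> B * (LINT z|haar_Theta \<theta>. norm (\<Sum>j\<in>UNIV. c j * cnj (z $ j)))"
proof -
  have "0 < B" using A by (metis ennreal_neg leI not_less_zero)
  define p where "p z = (\<Sum>j\<in>UNIV. c j * cnj (z $ j))" for z :: "complex ^ 'm"
  define x where "x n = Psi_Theta \<theta> (int n)" for n :: nat
  have contp: "continuous_on UNIV (\<lambda>z. norm (p z))" unfolding p_def by (intro continuous_intros)
  have bp: "bounded (range (\<lambda>n. norm (p (x n))))"
    unfolding x_def by (rule bounded_range_G_Theta[OF contp])
  obtain n0 where n0: "\<And>n. n \<ge> n0 \<Longrightarrow> norm (F n) \<le> B"
  proof -
    have "eventually (\<lambda>n. ennreal (norm (F n)) < ennreal B) sequentially"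
      using A unfolding A_inf_eq_limsup by (rule Limsup_lessD)
    then obtain n0 where "\<And>n. n \<ge> n0 \<Longrightarrow> ennreal (norm (F n)) < ennreal B"
      unfolding eventually_sequentially by blast
    then have "\<And>n. n \<ge> n0 \<Longrightarrow> norm (F n) \<le> B"
      using \<open>0 < B\<close> by (metis ennreal_less_iff less_imp_le norm_ge_zero)
    then show ?thesis by (rule that)
  qed
  define e where "e n = (if n < n0 then norm (F n) else 0)" for n
  have Fe: "norm (F n) \<le> B + e n" for n
    using n0[of n] \<open>0 < B\<close> by (auto simp: e_def)
  have be: "bounded (range e)"
  proof (rule finite_imp_bounded, rule finite_subset)
    show "range e \<subseteq> insert 0 (e ` {..<n0})" by (auto simp: e_def)
  qed simp
  have bF: "bounded (range F)"
  proof -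
    obtain E where "\<And>n. norm (e n) \<le> E" using be by (auto simp: bounded_iff)
    then have "norm (F n) \<le> B + E" for n
      using Fe[of n] by (metis abs_le_D1 add_left_mono order_trans real_norm_def)
    then show ?thesis by (auto simp: bounded_iff)
  qed
  have bmul: "bounded (range (\<lambda>n. f n * g n))" if fg: "bounded (range f)" "bounded (range g)"
    for f g :: "nat \<Rightarrow> 'b::real_normed_div_algebra"
  proof -
    obtain P Q where "\<And>n. norm (f n) \<le> P" "\<And>n. norm (g n) \<le> Q"
      using fg by (auto simp: bounded_iff)
    then have "norm (f n * g n) \<le> P * Q" for n
      unfolding norm_mult by (intro mult_mono) (auto intro: order.trans[OF norm_ge_zero])
    then show ?thesis by (auto simp: bounded_iff)
  qed
  have bpe: "bounded (range (\<lambda>n. e n * norm (p (x n))))"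
    by (rule bmul[OF be bp])
  have bx: "bounded (range (\<lambda>n. cnj (x n $ j)))" for j
    unfolding x_def by (rule bounded_range_G_Theta) (intro continuous_intros)
  have bFp: "bounded (range (\<lambda>n. F n * p (x n)))"
    using bp by (intro bmul[OF bF]) (simp add: bounded_iff)
  have ev: "\<forall>\<^sub>F r in at_left (1::real). r \<in> {0<..<1}"
    by (rule eventually_at_leftI) auto
  define S where "S r = of_real (1 - r) * (\<Sum>n. F n * p (x n) * of_real r ^ n)" for r :: real
  have "(S \<longlongrightarrow> (\<Sum>j\<in>UNIV. c j * a $ j)) (at_left 1)"
  proof (rule Lim_transform_eventually)
    show "((\<lambda>r. \<Sum>j\<in>UNIV. c j * (of_real (1 - r) *
          (\<Sum>n. F n * of_real r ^ n * exp (- (\<i> * of_nat n * of_real (\<theta> $ j))))))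
        \<longlongrightarrow> (\<Sum>j\<in>UNIV. c j * a $ j)) (at_left 1)"
      using coeff unfolding has_abel_coeff_def by (intro tendsto_sum tendsto_mult tendsto_const)
    show "\<forall>\<^sub>F r in at_left 1. (\<Sum>j\<in>UNIV. c j * (of_real (1 - r) *
          (\<Sum>n. F n * of_real r ^ n * exp (- (\<i> * of_nat n * of_real (\<theta> $ j)))))) = S r"
      using ev
    proof eventually_elim
      case (elim r)
      have ex: "exp (- (\<i> * of_nat n * of_real (\<theta> $ j))) = cnj (x n $ j)" for n j
        by (simp add: x_def cnj_Psi_Theta_nth)
      have sm: "summable (\<lambda>n. F n * of_real r ^ n * cnj (x n $ j))" for j
        using summable_bounded_power(2)[OF bmul[OF bF bx[of j]], of r] elim by (simp add: mult_ac)
      have "(\<Sum>j\<in>UNIV. c j * (\<Sum>n. F n * of_real r ^ n * cnj (x n $ j)))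
          = (\<Sum>j\<in>UNIV. \<Sum>n. c j * (F n * of_real r ^ n * cnj (x n $ j)))"
        by (simp add: suminf_mult[OF sm])
      also have "\<dots> = (\<Sum>n. \<Sum>j\<in>UNIV. c j * (F n * of_real r ^ n * cnj (x n $ j)))"
        by (rule suminf_sum[symmetric]) (intro summable_mult sm)
      also have "\<dots> = (\<Sum>n. F n * p (x n) * of_real r ^ n)"
        by (simp add: p_def sum_distrib_left sum_distrib_right mult_ac)
      finally have *: "(\<Sum>j\<in>UNIV. c j * (\<Sum>n. F n * of_real r ^ n * cnj (x n $ j)))
        = (\<Sum>n. F n * p (x n) * of_real r ^ n)" .
      show ?case
        unfolding S_def ex *[symmetric] sum_distrib_left by (simp only: mult_ac)
    qed
  qed
  then have lower: "((\<lambda>r. norm (S r)) \<longlongrightarrow> norm (\<Sum>j\<in>UNIV. c j * a $ j)) (at_left 1)"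
    by (rule tendsto_norm)
  have "((\<lambda>r. B * abel_mean r (\<lambda>n. norm (p (x n))) + abel_mean r (\<lambda>n. e n * norm (p (x n))))
      \<longlongrightarrow> B * (LINT z|haar_Theta \<theta>. norm (p z)) + 0) (at_left 1)"
    unfolding x_def
    by (intro tendsto_add tendsto_mult tendsto_const equidistribution[OF contp]
        abel_mean_finite_support[of n0]) (simp add: e_def)
  moreover have "\<forall>\<^sub>F r in at_left 1. norm (S r)
      \<le> B * abel_mean r (\<lambda>n. norm (p (x n))) + abel_mean r (\<lambda>n. e n * norm (p (x n)))"
    using ev
  proof eventually_elim
    case (elim r)
    then have r: "0 < r" "r < 1" by auto
    have sm: "summable (\<lambda>n. norm (F n * p (x n) * of_real r ^ n))"
      using summable_bounded_power(1)[OF bFp r] r by (simp add: norm_mult norm_power)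
    have "norm (S r) = (1 - r) * norm (\<Sum>n. F n * p (x n) * of_real r ^ n)"
      using r by (simp add: S_def norm_mult del: of_real_diff)
    also have "\<dots> \<le> (1 - r) * (\<Sum>n. norm (F n * p (x n) * of_real r ^ n))"
      using r by (intro mult_left_mono summable_norm sm) auto
    also have "\<dots> = abel_mean r (\<lambda>n. norm (F n * p (x n)))"
      using r by (simp add: abel_mean_def norm_mult norm_power)
    also have "\<dots> \<le> abel_mean r (\<lambda>n. B * norm (p (x n)) + e n * norm (p (x n)))"
    proof (rule abel_mean_mono[OF _ _ r])
      show "bounded (range (\<lambda>n. norm (F n * p (x n))))" using bFp by (simp add: bounded_iff)
      show "bounded (range (\<lambda>n. B * norm (p (x n)) + e n * norm (p (x n))))"
        by (intro bounded_range_add bounded_range_cmult bp bpe)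
      show "norm (F n * p (x n)) \<le> B * norm (p (x n)) + e n * norm (p (x n))" for n
        using mult_right_mono[OF Fe[of n], of "norm (p (x n))"] by (simp add: norm_mult distrib_right)
    qed
    also have "\<dots> = B * abel_mean r (\<lambda>n. norm (p (x n))) + abel_mean r (\<lambda>n. e n * norm (p (x n)))"
      by (simp add: abel_mean_add[OF bounded_range_cmult[OF bp] bpe r] abel_mean_cmult[OF bp r])
    finally show ?case .
  qed
  ultimately show ?thesis
    using tendsto_le[OF trivial_limit_at_left_real _ lower] by (simp add: p_def)
qed

lemma Linf_coefficients_bounded:
  fixes \<theta> :: "real ^ 'm" and a :: "complex ^ 'm" and c :: "'m \<Rightarrow> complex"
  assumes f: "f \<in> Linf (haar_Theta \<theta>)"
    and a: "\<And>j. (LINT z|haar_Theta \<theta>. f z * cnj (z $ j)) = a $ j"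
  shows "norm (\<Sum>j\<in>UNIV. c j * a $ j)
    \<le> enn2real (Linf_norm (haar_Theta \<theta>) f) * (LINT z|haar_Theta \<theta>. norm (\<Sum>j\<in>UNIV. c j * cnj (z $ j)))"
proof -
  interpret prob_space "haar_Theta \<theta>" by (rule prob_space_haar_Theta)
  define A where "A = enn2real (Linf_norm (haar_Theta \<theta>) f)"
  define p where "p z = (\<Sum>j\<in>UNIV. c j * cnj (z $ j))" for z :: "complex ^ 'm"
  have contp: "continuous_on UNIV p" unfolding p_def by (intro continuous_intros)
  have fin: "Linf_norm (haar_Theta \<theta>) f < \<infinity>" and fm: "f \<in> borel_measurable (haar_Theta \<theta>)"
    using f by (auto simp: Linf_def)
  have "AE z in haar_Theta \<theta>. ennreal (norm (f z)) \<le> Linf_norm (haar_Theta \<theta>) f"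
    unfolding Linf_norm_def by (rule esssup_AE)
  moreover have "Linf_norm (haar_Theta \<theta>) f = ennreal A" "0 \<le> A"
    using fin by (simp_all add: A_def)
  ultimately have fA: "AE z in haar_Theta \<theta>. norm (f z) \<le> A" by simp
  have intf: "integrable (haar_Theta \<theta>) (\<lambda>z. f z * h z)" if h: "continuous_on UNIV h" for h
  proof (rule Bochner_Integration.integrable_bound)
    show "integrable (haar_Theta \<theta>) (\<lambda>z. A * norm (h z))"
      by (intro integrable_haar_Theta continuous_intros h)
    show "(\<lambda>z. f z * h z) \<in> borel_measurable (haar_Theta \<theta>)"
      by (intro borel_measurable_times fm measurable_haar_Theta h)
    show "AE z in haar_Theta \<theta>. norm (f z * h z) \<le> norm (A * norm (h z))"
      using fA by eventually_elim (simp add: norm_mult mult_right_mono \<open>0 \<le> A\<close>)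
  qed
  have "(\<Sum>j\<in>UNIV. c j * a $ j) = (\<Sum>j\<in>UNIV. (LINT z|haar_Theta \<theta>. c j * (f z * cnj (z $ j))))"
    by (simp add: a)
  also have "\<dots> = (LINT z|haar_Theta \<theta>. (\<Sum>j\<in>UNIV. c j * (f z * cnj (z $ j))))"
    by (rule Bochner_Integration.integral_sum[symmetric])
       (intro integrable_mult_right intf continuous_intros)
  also have "\<dots> = (LINT z|haar_Theta \<theta>. f z * p z)"
    by (simp add: p_def sum_distrib_left mult_ac)
  also have "norm \<dots> \<le> (LINT z|haar_Theta \<theta>. norm (f z * p z))"
    by (rule integral_norm_bound)
  also have "\<dots> \<le> (LINT z|haar_Theta \<theta>. A * norm (p z))"
  proof (rule integral_mono_AE)
    show "integrable (haar_Theta \<theta>) (\<lambda>z. norm (f z * p z))"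
      by (intro integrable_norm intf contp)
    show "integrable (haar_Theta \<theta>) (\<lambda>z. A * norm (p z))"
      by (intro integrable_haar_Theta continuous_intros contp)
    show "AE z in haar_Theta \<theta>. norm (f z * p z) \<le> A * norm (p z)"
      using fA by eventually_elim (simp add: norm_mult mult_right_mono)
  qed
  also have "\<dots> = A * (LINT z|haar_Theta \<theta>. norm (p z))" by simp
  finally show ?thesis by (simp add: A_def p_def)
qed

lemma q_Theta_le_continuous:
  fixes \<theta> :: "real ^ 'm" and a :: "complex ^ 'm"
  assumes g: "continuous_on UNIV g" "\<And>z. z \<in> G_Theta \<theta> \<Longrightarrow> norm (g z) \<le> B"
    and a: "\<And>j. (LINT z|haar_Theta \<theta>. g z * cnj (z $ j)) = a $ j"
  shows "q_Theta \<theta> a \<le> ennreal B"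
proof -
  have gm: "g \<in> borel_measurable (haar_Theta \<theta>)" by (rule measurable_haar_Theta[OF g(1)])
  have le: "Linf_norm (haar_Theta \<theta>) g \<le> ennreal B"
    unfolding Linf_norm_def
    by (rule esssup_I) (use gm g(2) in \<open>auto simp: space_haar_Theta intro!: ennreal_leI\<close>)
  then have "g \<in> Linf (haar_Theta \<theta>)"
    using gm by (simp add: Linf_def le_less_trans)
  then show ?thesis
    unfolding q_Theta_def using a le by (intro INF_lower2[of g]) auto
qed

lemma sampled_continuous:
  fixes \<theta> :: "real ^ 'm" and a :: "complex ^ 'm"
  assumes g: "continuous_on UNIV g" "\<And>z. z \<in> G_Theta \<theta> \<Longrightarrow> norm (g z) \<le> B"
    and a: "\<And>j. (LINT z|haar_Theta \<theta>. g z * cnj (z $ j)) = a $ j"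
  defines "F \<equiv> \<lambda>n. g (Psi_Theta \<theta> (int n))"
  shows "abel_convergent F" "has_abel_coeff F (\<theta> $ j) (a $ j)" "A_inf F \<le> ennreal B"
proof -
  show "abel_convergent F"
    unfolding abel_convergent_def F_def
    by (intro allI impI summable_bounded_power(1) bounded_range_G_Theta g(1)) auto
  have "continuous_on UNIV (\<lambda>z. g z * cnj (z $ j))" by (intro continuous_intros g(1))
  from equidistribution_complex[OF this, of \<theta>]
  show "has_abel_coeff F (\<theta> $ j) (a $ j)"
    unfolding has_abel_coeff_def F_def a
    by (simp add: cnj_Psi_Theta_nth mult_ac)
  show "A_inf F \<le> ennreal B"
    unfolding A_inf_eq_limsup F_def
    by (intro Limsup_bounded always_eventually allI ennreal_leI g(2) Psi_Theta_in_G)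
qed

section \<open>The extremal problem\<close>

theorem theorem34p2:
  fixes \<theta> :: "real ^ 'm"
  assumes "distinct_phases \<theta>"
  shows "(\<forall>F a. abel_convergent F \<and> (\<forall>j. has_abel_coeff F (\<theta> $ j) (a $ j)) \<longrightarrow> A_inf F \<ge> q_Theta \<theta> a)
    \<and> (\<forall>a. q_Theta \<theta> a =
          (INF F \<in> {F. abel_convergent F \<and> (\<forall>j. has_abel_coeff F (\<theta> $ j) (a $ j))}. A_inf F))"
proof -
  have lower: "q_Theta \<theta> a \<le> A_inf F" if coeff: "\<And>j. has_abel_coeff F (\<theta> $ j) (a $ j)" for F a
  proof (rule ennreal_le_epsilon)
    fix e :: real assume fin: "A_inf F < top" and "0 < e"
    define A where "A = enn2real (A_inf F)"
    have A: "A_inf F = ennreal A" "0 \<le> A" using fin by (simp_all add: A_def)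
    have "A_inf F < ennreal (A + e / 2)"
      using A \<open>0 < e\<close> by (simp add: ennreal_less_iff)
    note bound = abel_coefficients_bounded[OF coeff this]
    obtain g where "continuous_on UNIV g" "\<And>z. z \<in> G_Theta \<theta> \<Longrightarrow> norm (g z) \<le> A + e / 2 + e / 2"
      "\<And>j. (LINT z|haar_Theta \<theta>. g z * cnj (z $ j)) = a $ j"
      by (rule bounded_coefficients_imp_continuous[OF assms _ _ bound, of "e / 2"])
         (use A \<open>0 < e\<close> in simp, use \<open>0 < e\<close> in simp, rule that, assumption+)
    then have "q_Theta \<theta> a \<le> ennreal (A + e / 2 + e / 2)"
      by (rule q_Theta_le_continuous)
    also have "\<dots> = A_inf F + ennreal e"
      using A \<open>0 < e\<close> by (simp flip: ennreal_plus)
    finally show "q_Theta \<theta> a \<le> A_inf F + ennreal e" .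
  qed
  have upper: "(INF F \<in> {F. abel_convergent F \<and> (\<forall>j. has_abel_coeff F (\<theta> $ j) (a $ j))}. A_inf F)
      \<le> q_Theta \<theta> a" (is "?inf \<le> _") for a
    unfolding q_Theta_def
  proof (rule INF_greatest, rule ennreal_le_epsilon)
    fix f and e :: real
    assume "f \<in> {f \<in> Linf (haar_Theta \<theta>). \<forall>j. (LINT z|haar_Theta \<theta>. f z * cnj (z $ j)) = a $ j}"
    then have f: "f \<in> Linf (haar_Theta \<theta>)" "\<And>j. (LINT z|haar_Theta \<theta>. f z * cnj (z $ j)) = a $ j"
      by auto
    assume "Linf_norm (haar_Theta \<theta>) f < top" and "0 < e"
    define A where "A = enn2real (Linf_norm (haar_Theta \<theta>) f)"
    have A: "Linf_norm (haar_Theta \<theta>) f = ennreal A" "0 \<le> A"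
      using \<open>Linf_norm (haar_Theta \<theta>) f < top\<close> by (simp_all add: A_def)
    note bound = Linf_coefficients_bounded[OF f, folded A_def]
    obtain g where g: "continuous_on UNIV g" "\<And>z. z \<in> G_Theta \<theta> \<Longrightarrow> norm (g z) \<le> A + e"
      "\<And>j. (LINT z|haar_Theta \<theta>. g z * cnj (z $ j)) = a $ j"
      by (rule bounded_coefficients_imp_continuous[OF assms A(2) \<open>0 < e\<close> bound]) (rule that, assumption+)
    have "?inf \<le> ennreal (A + e)"
      using sampled_continuous[OF g] by (intro INF_lower2[of "\<lambda>n. g (Psi_Theta \<theta> (int n))"]) auto
    then show "?inf \<le> Linf_norm (haar_Theta \<theta>) f + ennreal e"
      using A \<open>0 < e\<close> by (simp add: ennreal_plus)
  qed
  show ?thesis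
  proof (intro conjI allI impI)
    fix F a
    assume "abel_convergent F \<and> (\<forall>j. has_abel_coeff F (\<theta> $ j) (a $ j))"
    then show "q_Theta \<theta> a \<le> A_inf F" by (intro lower) simp
  next
    fix a
    show "q_Theta \<theta> a = (INF F \<in> {F. abel_convergent F \<and> (\<forall>j. has_abel_coeff F (\<theta> $ j) (a $ j))}. A_inf F)"
      by (rule antisym[OF INF_greatest upper]) (auto intro: lower)
  qed
qed

end
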